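(* Let $X$ be a centered Gaussian process with stationary increments and almost surely continuous sample paths whose variance function $\sigma^2$ satisfies assumptions AI and AII (stated in the context), let $c>0$, and let $Q_X(t)=\sup_{-\infty<s\le t}\left(X(t)-X(s)-c(t-s)\right)$. Then, almost surely, \[ \limsup_{t\to\infty}\frac{Q_X(t)}{(\log t)^{\frac{1}{2(1-\alpha_\infty)}}}=\left(\frac{2A_\infty}{A^2}\right)^{\frac{1}{2(1-\alpha_\infty)}}, \] where \[ A=\left(\frac{\alpha_\infty}{c(1-\alpha_\infty)}\right)^{-\alpha_\infty}\frac{1}{1-\alpha_\infty}. \]
   Context: $X=\{X(t):t\in\mathbb R\}$ is a centered Gaussian process with stationary increments, $X(0)=0$, and a.s. continuous sample paths; $\sigma^2(t)=\mathrm{Var}(X(t))$, so that $\mathrm{Var}(X(t)-X(s))=\sigma^2(|t-s|)$. The constant $c>0$ is fixed. Assumption AI: $\lim_{t\to\infty}\sigma^2(t)/t^{2\alpha_\infty}=A_\infty$ for some $A_\infty>0$, $\alpha_\infty\in(0,1)$. Further, $\sigma^2$ is positive and twice continuously differentiable on $(0,\infty)$, and its first and second derivatives are ultimately monotone at $\infty$ (a function is ultimately monotone if it is monotone on $(M,\infty)$ for some $M>0$). Assumption AII: $\lim_{t\to0^+}\sigma^2(t)/t^{2\alpha_0}=A_0$ for some $A_0>0$, $\alpha_0\in(0,1]$. *)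

theory Defs
  imports "HOL-Probability.Probability"
begin

text \<open>The degenerate law concentrated at 0 counts as Gaussian (variance 0).\<close>

definition centered_gaussian :: "'w measure \<Rightarrow> ('w \<Rightarrow> real) \<Rightarrow> bool" where
  "centered_gaussian M Y \<longleftrightarrow>
     Y \<in> borel_measurable M \<and>
     ((AE \<omega> in M. Y \<omega> = 0) \<or>
      (\<exists>s>0. distributed M lborel Y (\<lambda>x. ennreal (normal_density 0 s x))))"

definition centered_gaussian_process :: "'w measure \<Rightarrow> ('i \<Rightarrow> 'w \<Rightarrow> real) \<Rightarrow> bool" where
  "centered_gaussian_process M X \<longleftrightarrow>
     (\<forall>T a. finite T \<longrightarrow> centered_gaussian M (\<lambda>\<omega>. \<Sum>t\<in>T. a t * X t \<omega>))"

text \<open>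
  Equality of laws on the product sigma-algebra, i.e. of all finite-dimensional distributions.
\<close>

definition stationary_increments :: "'w measure \<Rightarrow> (real \<Rightarrow> 'w \<Rightarrow> real) \<Rightarrow> bool" where
  "stationary_increments M X \<longleftrightarrow>
     (\<forall>h. distr M (\<Pi>\<^sub>M t\<in>UNIV. borel) (\<lambda>\<omega> t. X (t + h) \<omega> - X h \<omega>) =
          distr M (\<Pi>\<^sub>M t\<in>UNIV. borel) (\<lambda>\<omega> t. X t \<omega> - X 0 \<omega>))"

definition variance_function :: "'w measure \<Rightarrow> (real \<Rightarrow> 'w \<Rightarrow> real) \<Rightarrow> real \<Rightarrow> real" where
  "variance_function M X t = prob_space.variance M (X t)"

definition ultimately_monotone :: "(real \<Rightarrow> real) \<Rightarrow> bool" where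
  "ultimately_monotone f \<longleftrightarrow> (\<exists>K>0. mono_on {K<..} f \<or> antimono_on {K<..} f)"

definition twice_continuously_differentiable_pos :: "(real \<Rightarrow> real) \<Rightarrow> bool" where
  "twice_continuously_differentiable_pos f \<longleftrightarrow>
     (\<forall>t>0. f differentiable (at t)) \<and>
     (\<forall>t>0. deriv f differentiable (at t)) \<and>
     continuous_on {0<..} (deriv (deriv f))"

definition assumption_AI :: "(real \<Rightarrow> real) \<Rightarrow> real \<Rightarrow> real \<Rightarrow> bool" where
  "assumption_AI v A \<alpha> \<longleftrightarrow>
     A > 0 \<and> 0 < \<alpha> \<and> \<alpha> < 1 \<and>
     ((\<lambda>t. v t / t powr (2 * \<alpha>)) \<longlongrightarrow> A) at_top \<and>
     (\<forall>t>0. v t > 0) \<and>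
     twice_continuously_differentiable_pos v \<and>
     ultimately_monotone (deriv v) \<and>
     ultimately_monotone (deriv (deriv v))"

definition assumption_AII :: "(real \<Rightarrow> real) \<Rightarrow> real \<Rightarrow> real \<Rightarrow> bool" where
  "assumption_AII v A \<alpha> \<longleftrightarrow>
     A > 0 \<and> 0 < \<alpha> \<and> \<alpha> \<le> 1 \<and>
     ((\<lambda>t. v t / t powr (2 * \<alpha>)) \<longlongrightarrow> A) (at_right 0)"

text \<open>
  The supremum is taken in the extended reals, so that it is meaningful also on sample paths
  where the set is unbounded.
\<close>

definition storage_process :: "(real \<Rightarrow> 'w \<Rightarrow> real) \<Rightarrow> real \<Rightarrow> real \<Rightarrow> 'w \<Rightarrow> ereal" where
  "storage_process X c t \<omega> = (SUP s\<in>{..t}. ereal (X t \<omega> - X s \<omega> - c * (t - s)))"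

definition storage_const :: "real \<Rightarrow> real \<Rightarrow> real" where
  "storage_const c \<alpha> = (\<alpha> / (c * (1 - \<alpha>))) powr (- \<alpha>) * (1 / (1 - \<alpha>))"

end

(*
  An increment of length tau exceeds u + c tau with probability about
  exp (- (u + c tau)^2 / (2 sigma^2(tau))). By weighted AM-GM the exponent is smallest at
  tau = u alpha / (c (1 - alpha)), where it is asymptotically A^2 u^(2 - 2 alpha) / (2 A_inf), and it
  balances ln t exactly at the claimed level.

  Upper bound: compare t and s with the integer grid. The grid increments are handled by a union
  bound, and the oscillation over unit intervals has genuinely Gaussian tails by dyadic chaining,
  which are negligible because u^2 dominates u^(2 - 2 alpha). Borel-Cantelli applies along integers.

  Lower bound: look only at the optimal increments ending at t_n = n^(1 + delta). Their covariances
  are second differences of sigma^2; ultimate monotonicity of the derivatives gives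
  sigma^2''(t) = O(t^(2 alpha - 2)), so correlations decay like a power of n, whereas the events have
  probability at least 1/n. The conditional normal density shows that such weakly correlated events
  are pairwise almost independent, and the second moment form of Borel-Cantelli applies.
*)

theory Submission
  imports Defs "HOL-Real_Asymp.Real_Asymp"
begin

text \<open>The supremum over uncountably many s is never treated as a random variable:
  probabilities are estimated only for countable families of events, and the passage to all s and t
  is made path by path. Both bounds work with ln t multiplied by a slack factor \<theta>, greater
  than 1 above and less than 1 below; \<theta> goes to 1 along a sequence at the end. In the upper
  bound the minimal exponent is uniform in the length of the increment, so it cannot be summed over
  infinitely many grid lengths. A small share of the exponent is therefore replaced by a cruder
  bound that grows with the length. In the lower bound half-lines would not do: the ratio of the
  conditional to the unconditional normal density grows like exp (r x y) and is unbounded there.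
  Unit windows above the level keep x and y of order sqrt (ln n) and still have probability at least
  1/n. The exponent 1 + \<delta> makes consecutive times at least n powr \<delta> apart, which
  dominates the optimal lengths (powers of ln n), while ln t_n = (1 + \<delta>) ln n costs only the
  factor 1 + \<delta>.\<close>

section \<open>Centered Gaussian variables\<close>

context prob_space
begin

lemma centered_gaussian_moments:
  assumes "centered_gaussian M Y"
  shows "integrable M Y" "integrable M (\<lambda>\<omega>. (Y \<omega>)\<^sup>2)" "expectation Y = 0"
    "variance Y = expectation (\<lambda>\<omega>. (Y \<omega>)\<^sup>2)"
proof -
  have [measurable]: "Y \<in> borel_measurable M"
    using assms by (simp add: centered_gaussian_def)
  have *: "integrable M Y \<and> integrable M (\<lambda>\<omega>. (Y \<omega>)\<^sup>2) \<and> expectation Y = 0"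
    using assms unfolding centered_gaussian_def
  proof (elim conjE disjE exE)
    assume "AE \<omega> in M. Y \<omega> = 0"
    then have "AE \<omega> in M. Y \<omega> = (\<lambda>_. 0) \<omega>" "AE \<omega> in M. (Y \<omega>)\<^sup>2 = (\<lambda>_. 0) \<omega>" by auto
    then show ?thesis
      using integrable_cong_AE[of Y M "\<lambda>_. 0"] integrable_cong_AE[of "\<lambda>\<omega>. (Y \<omega>)\<^sup>2" M "\<lambda>_. 0"]
        integral_cong_AE[of Y M "\<lambda>_. 0"] by auto
  next
    fix s :: real assume s: "s > 0"
      and D: "distributed M lborel Y (\<lambda>x. ennreal (normal_density 0 s x))"
    have "integrable M (\<lambda>\<omega>. Y \<omega> ^ k)" for k
      using distributed_integrable[OF D, of "\<lambda>x. x ^ k"] integrable_normal_moment[OF s, of 0 k]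
      by simp
    from this[of 1] this[of 2] show ?thesis
      using normal_distributed_expectation[OF s D] by simp
  qed
  then show "integrable M Y" "integrable M (\<lambda>\<omega>. (Y \<omega>)\<^sup>2)" "expectation Y = 0" by auto
  then show "variance Y = expectation (\<lambda>\<omega>. (Y \<omega>)\<^sup>2)" by simp
qed

lemma centered_gaussian_variance_pos:
  assumes "centered_gaussian M Y" "variance Y > 0"
  shows "distributed M lborel Y (\<lambda>x. ennreal (normal_density 0 (sqrt (variance Y)) x))"
  using assms(1) unfolding centered_gaussian_def
proof (elim conjE disjE exE)
  assume "AE \<omega> in M. Y \<omega> = 0" and [measurable]: "Y \<in> borel_measurable M"
  then have "expectation (\<lambda>\<omega>. (Y \<omega>)\<^sup>2) = expectation (\<lambda>\<omega>. 0)"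
    by (intro integral_cong_AE) auto
  then show ?thesis
    using assms(2) centered_gaussian_moments[OF assms(1)] by simp
next
  fix s :: real assume s: "s > 0"
    and D: "distributed M lborel Y (\<lambda>x. ennreal (normal_density 0 s x))"
  then show ?thesis
    using normal_distributed_variance[OF s D] by simp
qed

lemma centered_gaussian_scale:
  assumes "centered_gaussian M Y"
  shows "centered_gaussian M (\<lambda>\<omega>. a * Y \<omega>)"
proof (cases "a = 0")
  case True
  then show ?thesis by (simp add: centered_gaussian_def)
next
  case False
  have [measurable]: "Y \<in> borel_measurable M"
    using assms by (simp add: centered_gaussian_def)
  show ?thesis
    using assms unfolding centered_gaussian_def
  proof (elim conjE disjE exE)
    fix s :: real assume s: "s > 0"
      and D: "distributed M lborel Y (\<lambda>x. ennreal (normal_density 0 s x))"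
    then show "(\<lambda>\<omega>. a * Y \<omega>) \<in> borel_measurable M \<and> ((AE \<omega> in M. a * Y \<omega> = 0) \<or>
      (\<exists>s>0. distributed M lborel (\<lambda>\<omega>. a * Y \<omega>) (\<lambda>x. ennreal (normal_density 0 s x))))"
      using normal_density_affine[OF D s, of a 0] False s
      by (auto intro!: exI[of _ "\<bar>a\<bar> * s"])
  qed auto
qed

text \<open>For y >= x >= 0 one has y^2 >= x^2 + (y - x)^2, so beyond x the density is at most exp
  (- x^2 / (2 s^2)) times the normal density centered at x, which has total mass 1.\<close>

lemma normal_tail:
  assumes "distributed M lborel Y (\<lambda>x. ennreal (normal_density 0 s x))" "s > 0" "x \<ge> 0"
  shows "prob {\<omega> \<in> space M. x \<le> Y \<omega>} \<le> exp (- x\<^sup>2 / (2 * s\<^sup>2))"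
proof -
  have "emeasure M {\<omega> \<in> space M. x \<le> Y \<omega>} = emeasure M (Y -` {x..} \<inter> space M)"
    by (rule arg_cong[where f = "emeasure M"]) auto
  also have "\<dots> = (\<integral>\<^sup>+y. ennreal (normal_density 0 s y) * indicator {x..} y \<partial>lborel)"
    by (rule distributed_emeasure[OF assms(1)]) auto
  also have "\<dots> \<le> (\<integral>\<^sup>+y. ennreal (exp (- x\<^sup>2 / (2 * s\<^sup>2))) * ennreal (normal_density x s y) \<partial>lborel)"
  proof (rule nn_integral_mono)
    fix y :: real
    have "normal_density 0 s y \<le> exp (- x\<^sup>2 / (2 * s\<^sup>2)) * normal_density x s y" if "x \<le> y"
    proof -
      have "x\<^sup>2 + (y - x)\<^sup>2 \<le> y\<^sup>2"
      proof -
        have "x * x \<le> x * y" using that \<open>x \<ge> 0\<close> by (rule mult_left_mono)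
        then show ?thesis by (simp add: power2_eq_square algebra_simps)
      qed
      then have "- y\<^sup>2 / (2 * s\<^sup>2) \<le> - x\<^sup>2 / (2 * s\<^sup>2) + - (y - x)\<^sup>2 / (2 * s\<^sup>2)"
        using \<open>s > 0\<close> by (simp add: field_simps)
      then have "exp (- y\<^sup>2 / (2 * s\<^sup>2)) \<le> exp (- x\<^sup>2 / (2 * s\<^sup>2)) * exp (- (y - x)\<^sup>2 / (2 * s\<^sup>2))"
        by (subst exp_add[symmetric]) simp
      then show ?thesis
        using \<open>s > 0\<close> by (simp add: normal_density_def divide_simps)
    qed
    then show "ennreal (normal_density 0 s y) * indicator {x..} y
        \<le> ennreal (exp (- x\<^sup>2 / (2 * s\<^sup>2))) * ennreal (normal_density x s y)"
      by (auto split: split_indicator simp: ennreal_mult[symmetric] intro!: ennreal_leI)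
  qed
  also have "\<dots> = ennreal (exp (- x\<^sup>2 / (2 * s\<^sup>2)))"
    by (subst nn_integral_cmult)
      (auto simp: nn_integral_eq_integral[OF integrable_normal_density[OF \<open>s > 0\<close>]] \<open>s > 0\<close>)
  finally show ?thesis
    by (simp add: emeasure_eq_measure)
qed

lemma centered_gaussian_tail:
  assumes Y: "centered_gaussian M Y" and V: "variance Y \<le> V" "V > 0" and x: "x > 0"
  shows "prob {\<omega> \<in> space M. x \<le> Y \<omega>} \<le> exp (- x\<^sup>2 / (2 * V))"
proof (cases "variance Y > 0")
  case True
  have "prob {\<omega> \<in> space M. x \<le> Y \<omega>} \<le> exp (- x\<^sup>2 / (2 * variance Y))"
    using normal_tail[OF centered_gaussian_variance_pos[OF Y True], of x] True x by simp
  also have "\<dots> \<le> exp (- x\<^sup>2 / (2 * V))"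
    using V True by (simp add: frac_le)
  finally show ?thesis .
next
  \<comment> \<open>Variance 0 excludes the density alternative, whose variance is s^2 > 0. Hence Y
    = 0 almost surely, and x > 0 makes the event null.\<close>
  case False
  have [measurable]: "Y \<in> borel_measurable M" using Y by (simp add: centered_gaussian_def)
  have "variance Y = s\<^sup>2" if "s > 0" "distributed M lborel Y (\<lambda>x. ennreal (normal_density 0 s x))" for s
    using normal_distributed_variance[OF that] .
  with False Y have "AE \<omega> in M. Y \<omega> = 0"
    unfolding centered_gaussian_def by (metis zero_less_power)
  then have "prob {\<omega> \<in> space M. x \<le> Y \<omega>} = 0"
    using x by (subst prob_Collect_eq_0) auto
  then show ?thesis by simp
qed

lemma centered_gaussian_abs_tail:
  assumes Y: "centered_gaussian M Y" and V: "variance Y \<le> V" "V > 0" and x: "x > 0"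
  shows "prob {\<omega> \<in> space M. x \<le> \<bar>Y \<omega>\<bar>} \<le> 2 * exp (- x\<^sup>2 / (2 * V))"
proof -
  have [measurable]: "Y \<in> borel_measurable M" using Y by (simp add: centered_gaussian_def)
  have Y': "centered_gaussian M (\<lambda>\<omega>. - Y \<omega>)"
    using centered_gaussian_scale[OF Y, of "-1"] by simp
  have "variance (\<lambda>\<omega>. - Y \<omega>) = variance Y"
    using centered_gaussian_moments[OF Y] by simp
  then have V': "variance (\<lambda>\<omega>. - Y \<omega>) \<le> V" using V by simp
  have "prob {\<omega> \<in> space M. x \<le> \<bar>Y \<omega>\<bar>} = prob ({\<omega> \<in> space M. x \<le> Y \<omega>} \<union> {\<omega> \<in> space M. x \<le> - Y \<omega>})"
    by (rule arg_cong[where f = prob]) auto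
  also have "\<dots> \<le> prob {\<omega> \<in> space M. x \<le> Y \<omega>} + prob {\<omega> \<in> space M. x \<le> - Y \<omega>}"
    by (rule measure_Un_le) auto
  also have "\<dots> \<le> 2 * exp (- x\<^sup>2 / (2 * V))"
    using centered_gaussian_tail[OF Y V x] centered_gaussian_tail[OF Y' V' V(2) x] by simp
  finally show ?thesis .
qed

text \<open>The formula covers the degenerate law too, so the factorization of joint characteristic
  functions later needs no case distinction.\<close>

lemma centered_gaussian_char:
  assumes "centered_gaussian M Y"
  shows "char (distr M borel Y) t = exp (- (t\<^sup>2 * variance Y) / 2)"
  using assms unfolding centered_gaussian_def
proof (elim conjE disjE exE)
  assume AE0: "AE \<omega> in M. Y \<omega> = 0" and [measurable]: "Y \<in> borel_measurable M"
  have "expectation (\<lambda>\<omega>. (Y \<omega>)\<^sup>2) = expectation (\<lambda>\<omega>. 0)"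
    using AE0 by (intro integral_cong_AE) auto
  then have v: "variance Y = 0"
    using centered_gaussian_moments[OF assms] by simp
  have "char (distr M borel Y) t = (CLINT \<omega>|M. iexp (t * Y \<omega>))"
    by (simp add: char_def integral_distr)
  also have "\<dots> = (CLINT \<omega>|M. 1)"
    using AE0 by (intro integral_cong_AE) auto
  finally show ?thesis by (simp add: v prob_space)
next
  fix s :: real assume s: "s > 0"
    and D: "distributed M lborel Y (\<lambda>x. ennreal (normal_density 0 s x))"
    and [measurable]: "Y \<in> borel_measurable M"
  \<comment> \<open>Reduction to the standard normal law: the characteristic function of Y at t is
    that of Y / s at t s.\<close>
  have D1: "distributed M lborel (\<lambda>x. Y x / s) std_normal_density"
    using normal_standard_normal_convert[of s Y 0] s D by simp
  then have d: "distr M borel (\<lambda>x. Y x / s) = std_normal_distribution"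
    by (simp add: distributed_def cong: distr_cong)
  have e: "(t * s) * (Y \<omega> / s) = t * Y \<omega>" for \<omega>
    using s by simp
  have "char (distr M borel Y) t = (CLINT \<omega>|M. iexp ((t * s) * (Y \<omega> / s)))"
    unfolding e by (simp add: char_def integral_distr)
  also have "\<dots> = char (distr M borel (\<lambda>x. Y x / s)) (t * s)"
    by (subst char_def, subst integral_distr) auto
  also have "\<dots> = exp (- (t * s)\<^sup>2 / 2)"
    by (simp add: d char_std_normal_distribution)
  finally show ?thesis
    using normal_distributed_variance[OF s D] by (simp add: power_mult_distrib)
qed

end

section \<open>Independence of uncorrelated Gaussian variables\<close>

context prob_space
begin

lemma expectation_indicator_vimage:
  fixes Z :: "'a \<Rightarrow> real"
  assumes [measurable]: "Z \<in> borel_measurable M" "B \<in> sets borel"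
  shows "expectation (\<lambda>\<omega>. indicat_real B (Z \<omega>)) = prob (Z -` B \<inter> space M)"
proof -
  have "expectation (\<lambda>\<omega>. indicat_real B (Z \<omega>)) = expectation (indicator (Z -` B \<inter> space M))"
    by (intro Bochner_Integration.integral_cong) (auto split: split_indicator)
  then show ?thesis by simp
qed

text \<open>If \<open>expectation g\<close> is positive, \<open>g\<close> divided by it is a
  probability density with respect to M. By \<open>eq\<close>, Y has the same characteristic
  function under the reweighted measure as under M, hence the same law. If the expectation is 0,
  then \<open>g\<close> vanishes almost everywhere and both sides are 0.\<close>

lemma char_weighted_imp_indep:
  fixes Y :: "'a \<Rightarrow> real" and g :: "'a \<Rightarrow> real"
  assumes [measurable]: "Y \<in> borel_measurable M" "g \<in> borel_measurable M"
    and g: "\<And>\<omega>. 0 \<le> g \<omega>" "\<And>\<omega>. g \<omega> \<le> K"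
    and eq: "\<And>t. (CLINT \<omega>|M. g \<omega> * iexp (t * Y \<omega>)) = expectation g * (CLINT \<omega>|M. iexp (t * Y \<omega>))"
    and B[measurable]: "B \<in> sets borel"
  shows "expectation (\<lambda>\<omega>. g \<omega> * indicator B (Y \<omega>)) = expectation g * prob (Y -` B \<inter> space M)"
proof -
  have int_g: "integrable M g"
    using g by (intro integrable_const_bound[of _ K]) auto
  have int_gY: "integrable M (\<lambda>\<omega>. g \<omega> * indicator B (Y \<omega>))"
    using g by (intro integrable_const_bound[of _ K]) (auto split: split_indicator intro: order_trans)
  define G where "G = expectation g"
  have "G \<ge> 0" unfolding G_def using g by (simp add: integral_nonneg_AE)
  then consider "G = 0" | "G > 0" by fastforce
  then show ?thesis
  proof cases
    case 1
    then have "AE \<omega> in M. g \<omega> = 0"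
      using integral_nonneg_eq_0_iff_AE[OF int_g] g by (simp add: G_def)
    then have "expectation (\<lambda>\<omega>. g \<omega> * indicator B (Y \<omega>)) = expectation (\<lambda>\<omega>. 0)"
      by (intro integral_cong_AE) auto
    then show ?thesis using 1 by (simp add: G_def)
  next
    case 2
    define D where "D = density M (\<lambda>\<omega>. ennreal (g \<omega> / G))"
    have "emeasure D (space D) = (\<integral>\<^sup>+\<omega>. ennreal (g \<omega> / G) \<partial>M)"
      unfolding D_def by (subst emeasure_density) (auto intro!: nn_integral_cong)
    also have "\<dots> = ennreal (expectation (\<lambda>\<omega>. g \<omega> / G))"
      using int_g g 2 by (intro nn_integral_eq_integral) auto
    also have "\<dots> = 1" using 2 by (simp add: G_def)
    finally interpret D: prob_space D by (rule prob_spaceI)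
    have [measurable]: "Y \<in> borel_measurable D" by (simp add: D_def)
    have "distr D borel Y = distr M borel Y"
    proof (rule Levy_uniqueness)
      show "real_distribution (distr D borel Y)" by (simp add: D.real_distribution_distr)
      show "real_distribution (distr M borel Y)" by (simp add: real_distribution_distr)
      show "char (distr D borel Y) = char (distr M borel Y)"
      proof
        fix t
        have "char (distr D borel Y) t = (CLINT \<omega>|D. iexp (t * Y \<omega>))"
          by (simp add: char_def integral_distr)
        also have "\<dots> = (CLINT \<omega>|M. (g \<omega> / G) *\<^sub>R iexp (t * Y \<omega>))"
          unfolding D_def using g 2 by (subst integral_density) auto
        also have "\<dots> = (CLINT \<omega>|M. (1 / complex_of_real G) * (g \<omega> * iexp (t * Y \<omega>)))"
          by (intro Bochner_Integration.integral_cong) (auto simp: scaleR_conv_of_real)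
        also have "\<dots> = (1 / complex_of_real G) * (CLINT \<omega>|M. g \<omega> * iexp (t * Y \<omega>))"
          by (rule integral_mult_right_zero)
        also have "\<dots> = (CLINT \<omega>|M. iexp (t * Y \<omega>))"
          using 2 by (subst eq) (simp add: G_def)
        also have "\<dots> = char (distr M borel Y) t"
          by (simp add: char_def integral_distr)
        finally show "char (distr D borel Y) t = char (distr M borel Y) t" .
      qed
    qed
    then have "emeasure (distr D borel Y) B = emeasure (distr M borel Y) B" by simp
    then have "emeasure M (Y -` B \<inter> space M) = emeasure D (Y -` B \<inter> space M)"
      by (simp add: emeasure_distr) (simp add: D_def)
    also have "\<dots> = (\<integral>\<^sup>+\<omega>. ennreal (g \<omega> / G * indicator B (Y \<omega>)) \<partial>M)"
      unfolding D_def
      by (subst emeasure_density) (auto intro!: nn_integral_cong split: split_indicator)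
    also have "\<dots> = ennreal (expectation (\<lambda>\<omega>. g \<omega> / G * indicator B (Y \<omega>)))"
      using int_gY g 2 by (intro nn_integral_eq_integral) auto
    also have "expectation (\<lambda>\<omega>. g \<omega> / G * indicator B (Y \<omega>))
        = expectation (\<lambda>\<omega>. (1 / G) * (g \<omega> * indicator B (Y \<omega>)))"
      by (intro Bochner_Integration.integral_cong) auto
    also have "\<dots> = (1 / G) * expectation (\<lambda>\<omega>. g \<omega> * indicator B (Y \<omega>))"
      by (rule integral_mult_right_zero)
    finally have "prob (Y -` B \<inter> space M) = (1 / G) * expectation (\<lambda>\<omega>. g \<omega> * indicator B (Y \<omega>))"
      using g 2 by (simp add: emeasure_eq_measure integral_nonneg_AE)
    then show ?thesis using 2 by (simp add: G_def)
  qed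
qed

text \<open>Uniqueness is only available for laws on the real line, so it is applied twice: first under
  the change of measure with density proportional to \<open>1 + cos (a * Y)\<close> or \<open>1 + sin (a * Y)\<close>, then
  conditionally on the event \<open>Z \<in> B\<close>.\<close>

lemma indep_var_if_char:
  fixes Y Z :: "'a \<Rightarrow> real"
  assumes [measurable]: "Y \<in> borel_measurable M" "Z \<in> borel_measurable M"
    and char: "\<And>a b. (CLINT \<omega>|M. iexp (a * Y \<omega> + b * Z \<omega>))
      = (CLINT \<omega>|M. iexp (a * Y \<omega>)) * (CLINT \<omega>|M. iexp (b * Z \<omega>))"
  shows "indep_var borel Y borel Z"
proof -
  have int: "integrable M (\<lambda>\<omega>. iexp (f \<omega>))" if "f \<in> borel_measurable M" for f
    using that by (intro integrable_const_bound[of _ 1]) auto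
  have int_cos: "integrable M (\<lambda>\<omega>. cos (f \<omega>) * g \<omega>)" and int_sin: "integrable M (\<lambda>\<omega>. sin (f \<omega>) * g \<omega>)"
    if [measurable]: "f \<in> borel_measurable M" "g \<in> borel_measurable M" and g: "\<And>\<omega>. 0 \<le> g \<omega>" "\<And>\<omega>. g \<omega> \<le> (1::real)"
    for f g :: "'a \<Rightarrow> real"
    using g by (auto intro!: integrable_const_bound[of _ 1] simp: abs_mult mult_le_one)
  \<comment> \<open>A trigonometric factor in Y turns into exponentials at the frequencies (a, b)
    and (- a, b), to which \<open>char\<close> applies.\<close>
  have cos_eq: "complex_of_real (cos x) * iexp y = (iexp (x + y) + iexp (- x + y)) / 2"
   and sin_eq: "complex_of_real (sin x) * iexp y = (iexp (x + y) - iexp (- x + y)) / (2 * \<i>)" for x y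
    by (auto simp: complex_eq_iff Re_exp Im_exp cos_add sin_add cos_diff sin_diff Re_divide Im_divide)
  {
    fix B :: "real set" and a :: real assume [measurable]: "B \<in> sets borel"
    define f where "f b = (CLINT \<omega>|M. iexp (b * Z \<omega>))" for b
    define h where "h b = (CLINT \<omega>|M. iexp (b * Y \<omega>))" for b
    define m where "m = prob (Z -` B \<inter> space M)"
    have f0: "f 0 = 1" by (simp add: f_def prob_space)
    have char': "(CLINT \<omega>|M. iexp (a * Y \<omega> + b * Z \<omega>)) = h a * f b" for a b
      unfolding h_def f_def by (rule char)
    have char'': "(CLINT \<omega>|M. iexp (- (a * Y \<omega>) + b * Z \<omega>)) = h (- a) * f b" for b
      using char'[of "- a" b] by (simp only: mult_minus_left)
    have "(CLINT \<omega>|M. complex_of_real (cos (a * Y \<omega>)) * iexp (b * Z \<omega>)) = (h a + h (- a)) / 2 * f b" for b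
      unfolding cos_eq
      by (subst integral_divide_zero, subst Bochner_Integration.integral_add[OF int int])
        (simp_all only: char' char'' add_divide_distrib distrib_right times_divide_eq_left borel_measurable_add borel_measurable_times borel_measurable_const borel_measurable_uminus assms(1,2))
    note C = this
    have "(CLINT \<omega>|M. complex_of_real (sin (a * Y \<omega>)) * iexp (b * Z \<omega>)) = (h a - h (- a)) / (2 * \<i>) * f b" for b
      unfolding sin_eq
      by (subst integral_divide_zero, subst Bochner_Integration.integral_diff[OF int int])
        (simp_all only: char' char'' diff_divide_distrib left_diff_distrib times_divide_eq_left borel_measurable_add borel_measurable_times borel_measurable_const borel_measurable_uminus assms(1,2))
    note S = this
    have C': "complex_of_real (expectation (\<lambda>\<omega>. cos (a * Y \<omega>))) = (h a + h (- a)) / 2"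
      using C[of 0] f0 by (simp flip: integral_complex_of_real)
    have S': "complex_of_real (expectation (\<lambda>\<omega>. sin (a * Y \<omega>))) = (h a - h (- a)) / (2 * \<i>)"
      using S[of 0] f0 by (simp flip: integral_complex_of_real)
    have cmpl: "integrable M (\<lambda>\<omega>. complex_of_real (F (a * Y \<omega>)) * iexp (b * Z \<omega>))"
      if "F = cos \<or> F = sin" for F :: "real \<Rightarrow> real" and b
      using that by (intro integrable_const_bound[of _ 1]) (auto simp: norm_mult)
    \<comment> \<open>The weight must be nonnegative, so 1 + F replaces F; the contribution of the
      constant 1 is known and is subtracted at the end.\<close>
    have trig: "expectation (\<lambda>\<omega>. F (a * Y \<omega>) * indicator B (Z \<omega>)) = expectation (\<lambda>\<omega>. F (a * Y \<omega>)) * m"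
      if F: "F = cos \<or> F = sin" for F :: "real \<Rightarrow> real"
    proof -
      have F1: "- 1 \<le> F x" "F x \<le> 1" for x using F by auto
      have F2: "0 \<le> 1 + F x" "1 + F x \<le> 2" for x using F1[of x] by linarith+
      have [measurable]: "F \<in> borel_measurable borel" using F by auto
      have intF: "integrable M (\<lambda>\<omega>. F (a * Y \<omega>))"
        using F1 by (intro integrable_const_bound[of _ 1]) (auto simp: abs_le_iff minus_le_iff)
      have intFB: "integrable M (\<lambda>\<omega>. F (a * Y \<omega>) * indicator B (Z \<omega>))"
        using F1 by (intro integrable_const_bound[of _ 1]) (auto simp: abs_le_iff minus_le_iff split: split_indicator)
      have intB: "integrable M (\<lambda>\<omega>. indicator B (Z \<omega>) :: real)"
        by (intro integrable_const_bound[of _ 1]) auto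
      have EB: "expectation (\<lambda>\<omega>. indicator B (Z \<omega>)) = m"
        by (simp add: m_def expectation_indicator_vimage)
      have "(CLINT \<omega>|M. complex_of_real (1 + F (a * Y \<omega>)) * iexp (b * Z \<omega>))
          = expectation (\<lambda>\<omega>. 1 + F (a * Y \<omega>)) * (CLINT \<omega>|M. iexp (b * Z \<omega>))" for b
      proof -
        have "(CLINT \<omega>|M. complex_of_real (1 + F (a * Y \<omega>)) * iexp (b * Z \<omega>))
           = (CLINT \<omega>|M. iexp (b * Z \<omega>) + complex_of_real (F (a * Y \<omega>)) * iexp (b * Z \<omega>))"
          by (intro Bochner_Integration.integral_cong) (auto simp: algebra_simps)
        also have "\<dots> = f b + (CLINT \<omega>|M. complex_of_real (F (a * Y \<omega>)) * iexp (b * Z \<omega>))"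
          unfolding f_def by (intro Bochner_Integration.integral_add int cmpl F) auto
        also have "\<dots> = (1 + expectation (\<lambda>\<omega>. F (a * Y \<omega>))) * f b"
        proof -
          have F_eq: "(CLINT \<omega>|M. complex_of_real (F (a * Y \<omega>)) * iexp (b * Z \<omega>))
              = complex_of_real (expectation (\<lambda>\<omega>. F (a * Y \<omega>))) * f b"
            using F by (elim disjE) (simp_all only: C S C' S')
          show ?thesis unfolding F_eq by (simp add: algebra_simps)
        qed
        also have "1 + expectation (\<lambda>\<omega>. F (a * Y \<omega>)) = expectation (\<lambda>\<omega>. 1 + F (a * Y \<omega>))"
          using intF by (simp add: prob_space)
        finally show ?thesis by (simp add: f_def)
      qed
      then have "expectation (\<lambda>\<omega>. (1 + F (a * Y \<omega>)) * indicator B (Z \<omega>)) = expectation (\<lambda>\<omega>. 1 + F (a * Y \<omega>)) * m"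
        unfolding m_def using F2
        by (intro char_weighted_imp_indep[of _ _ 2]) auto
      moreover have "expectation (\<lambda>\<omega>. (1 + F (a * Y \<omega>)) * indicator B (Z \<omega>))
         = expectation (\<lambda>\<omega>. indicator B (Z \<omega>)) + expectation (\<lambda>\<omega>. F (a * Y \<omega>) * indicator B (Z \<omega>))"
        using intB intFB by (simp add: algebra_simps)
      moreover have "expectation (\<lambda>\<omega>. 1 + F (a * Y \<omega>)) = 1 + expectation (\<lambda>\<omega>. F (a * Y \<omega>))"
        using intF by (simp add: prob_space)
      ultimately show ?thesis by (simp add: EB algebra_simps)
    qed
    \<comment> \<open>The cosine and sine cases recombine: weighting by the event that Z lies in B
      multiplies the characteristic function of Y by the constant m. This is hypothesis
      \<open>eq\<close> of the reweighting lemma for that indicator.\<close>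
    have "(CLINT \<omega>|M. indicator B (Z \<omega>) * iexp (a * Y \<omega>))
        = (CLINT \<omega>|M. complex_of_real (cos (a * Y \<omega>) * indicator B (Z \<omega>))
             + \<i> * complex_of_real (sin (a * Y \<omega>) * indicator B (Z \<omega>)))"
      by (intro Bochner_Integration.integral_cong)
        (auto split: split_indicator simp: complex_eq_iff Re_exp Im_exp)
    also have "\<dots> = complex_of_real (expectation (\<lambda>\<omega>. cos (a * Y \<omega>) * indicator B (Z \<omega>)))
             + \<i> * complex_of_real (expectation (\<lambda>\<omega>. sin (a * Y \<omega>) * indicator B (Z \<omega>)))"
      by (subst Bochner_Integration.integral_add)
        (auto intro!: int_cos int_sin integrable_of_real integrable_mult_right
           simp del: of_real_mult simp: integral_complex_of_real)
    also have "\<dots> = complex_of_real m * ((h a + h (- a)) / 2 + \<i> * ((h a - h (- a)) / (2 * \<i>)))"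
      unfolding C'[symmetric] S'[symmetric] trig[OF disjI1[OF refl]] trig[OF disjI2[OF refl]]
      by (simp add: algebra_simps)
    also have "(h a + h (- a)) / 2 + \<i> * ((h a - h (- a)) / (2 * \<i>)) = h a"
      by (simp add: field_simps)
    finally have "(CLINT \<omega>|M. indicator B (Z \<omega>) * iexp (a * Y \<omega>)) = complex_of_real m * h a" .
    note this[unfolded m_def h_def]
  }
  note step = this
  have prod: "prob (Y -` C \<inter> space M \<inter> (Z -` B \<inter> space M)) = prob (Y -` C \<inter> space M) * prob (Z -` B \<inter> space M)"
    if [measurable]: "B \<in> sets borel" "C \<in> sets borel" for B C
  proof -
    have EB: "expectation (\<lambda>\<omega>. indicator B (Z \<omega>)) = prob (Z -` B \<inter> space M)"
      by (simp add: expectation_indicator_vimage)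
    have "prob (Y -` C \<inter> space M \<inter> (Z -` B \<inter> space M))
        = expectation (indicator (Y -` C \<inter> space M \<inter> (Z -` B \<inter> space M)))" by simp
    also have "\<dots> = expectation (\<lambda>\<omega>. indicator B (Z \<omega>) * indicator C (Y \<omega>))"
      by (intro Bochner_Integration.integral_cong) (auto split: split_indicator)
    also have "\<dots> = expectation (\<lambda>\<omega>. indicator B (Z \<omega>)) * prob (Y -` C \<inter> space M)"
    proof (rule char_weighted_imp_indep[of _ _ 1])
      fix t show "(CLINT \<omega>|M. complex_of_real (indicator B (Z \<omega>)) * iexp (t * Y \<omega>)) =
         complex_of_real (expectation (\<lambda>\<omega>. indicator B (Z \<omega>))) * (CLINT \<omega>|M. iexp (t * Y \<omega>))"
        unfolding EB of_real_indicator by (rule step) simp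
    qed auto
    finally show ?thesis by (simp add: EB)
  qed
  interpret Y: prob_space "distr M borel Y" by (rule prob_space_distr) simp
  interpret Z: prob_space "distr M borel Z" by (rule prob_space_distr) simp
  have "distr M borel Y \<Otimes>\<^sub>M distr M borel Z = distr M (borel \<Otimes>\<^sub>M borel) (\<lambda>\<omega>. (Y \<omega>, Z \<omega>))"
  proof (rule pair_measure_eqI)
    fix C B assume "C \<in> sets (distr M borel Y)" "B \<in> sets (distr M borel Z)"
    then have [measurable]: "C \<in> sets borel" "B \<in> sets borel" by auto
    have "(\<lambda>\<omega>. (Y \<omega>, Z \<omega>)) -` (C \<times> B) \<inter> space M = Y -` C \<inter> space M \<inter> (Z -` B \<inter> space M)" by auto
    then show "emeasure (distr M borel Y) C * emeasure (distr M borel Z) B =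
         emeasure (distr M (borel \<Otimes>\<^sub>M borel) (\<lambda>\<omega>. (Y \<omega>, Z \<omega>))) (C \<times> B)"
      by (simp add: emeasure_distr emeasure_eq_measure prod ennreal_mult)
  qed (auto intro: Y.sigma_finite_measure_axioms Z.sigma_finite_measure_axioms)
  then show ?thesis by (simp add: indep_var_distribution_eq)
qed

end

section \<open>Almost independent Gaussian events\<close>

text \<open>The left side is the conditional density of V given U = x for a standard Gaussian pair
  with correlation r. Up to the factor 1 / sqrt (1 - r^2), its ratio to the standard density has the
  exponent (2 r x y - (r x)^2 - (r y)^2) / (2 (1 - r^2)), whose only possibly positive term is
  controlled by the bounds P and Q.\<close>

lemma normal_density_conditional_le:
  fixes r x y :: real
  assumes r: "\<bar>r\<bar> < 1" and x: "0 \<le> x" "x \<le> P" and y: "0 \<le> y" "y \<le> Q"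
  shows "normal_density (r * x) (sqrt (1 - r\<^sup>2)) y
    \<le> exp (\<bar>r\<bar> * P * Q / (1 - r\<^sup>2)) / sqrt (1 - r\<^sup>2) * normal_density 0 1 y"
proof -
  have r2: "1 - r\<^sup>2 > 0" using r by (simp add: abs_square_less_1)
  have "r * x * y \<le> \<bar>r\<bar> * P * Q"
    using x y by (intro mult_mono) auto
  moreover have "0 \<le> (r * x)\<^sup>2" "0 \<le> (r * y)\<^sup>2" by auto
  ultimately have "y\<^sup>2 * (1 - r\<^sup>2) - (y - r * x)\<^sup>2 \<le> 2 * (\<bar>r\<bar> * P * Q)"
    by (simp add: power2_eq_square algebra_simps)
  then have "(y\<^sup>2 * (1 - r\<^sup>2) - (y - r * x)\<^sup>2) / (2 * (1 - r\<^sup>2)) \<le> 2 * (\<bar>r\<bar> * P * Q) / (2 * (1 - r\<^sup>2))"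
    using r2 by (intro divide_right_mono) auto
  then have "- (y - r * x)\<^sup>2 / (2 * (1 - r\<^sup>2)) \<le> \<bar>r\<bar> * P * Q / (1 - r\<^sup>2) + - y\<^sup>2 / 2"
  proof -
    have "(y\<^sup>2 * D - c) / (2 * D) = y\<^sup>2 / 2 - c / (2 * D)" "2 * b / (2 * D) = b / D" if "D > 0" for b c D :: real
      using that by (simp_all add: field_simps)
    from this[OF r2] show ?thesis using \<open>_ / (2 * (1 - r\<^sup>2)) \<le> _\<close> by simp
  qed
  then have "exp (- (y - r * x)\<^sup>2 / (2 * (1 - r\<^sup>2))) \<le> exp (\<bar>r\<bar> * P * Q / (1 - r\<^sup>2)) * exp (- y\<^sup>2 / 2)"
    by (subst exp_add[symmetric]) simp
  then have "exp (- (y - r * x)\<^sup>2 / (2 * (1 - r\<^sup>2))) / (sqrt (2 * pi) * sqrt (1 - r\<^sup>2))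
    \<le> exp (\<bar>r\<bar> * P * Q / (1 - r\<^sup>2)) * exp (- y\<^sup>2 / 2) / (sqrt (2 * pi) * sqrt (1 - r\<^sup>2))"
    using r2 by (intro divide_right_mono) auto
  moreover have "normal_density (r * x) (sqrt (1 - r\<^sup>2)) y
      = exp (- (y - r * x)\<^sup>2 / (2 * (1 - r\<^sup>2))) / (sqrt (2 * pi) * sqrt (1 - r\<^sup>2))"
    using r2 unfolding normal_density_def real_sqrt_mult[symmetric] by simp
  moreover have "normal_density 0 1 y = exp (- y\<^sup>2 / 2) / sqrt (2 * pi)"
    by (simp add: normal_density_def)
  ultimately show ?thesis by (simp only: times_divide_times_eq mult_ac)
qed

context prob_space
begin

section \<open>Pairs of jointly Gaussian variables\<close>

lemma jointly_gaussian_integrable_mult: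
  assumes lin: "\<And>a b. centered_gaussian M (\<lambda>\<omega>. a * Y \<omega> + b * Z \<omega>)"
  shows "integrable M (\<lambda>\<omega>. Y \<omega> * Z \<omega>)"
proof -
  have "integrable M (\<lambda>\<omega>. ((Y \<omega> + Z \<omega>)\<^sup>2 - (Y \<omega>)\<^sup>2 - (Z \<omega>)\<^sup>2) / 2)"
    using centered_gaussian_moments(2)[OF lin[of 1 1]] centered_gaussian_moments(2)[OF lin[of 1 0]]
      centered_gaussian_moments(2)[OF lin[of 0 1]] by simp
  then show ?thesis by (simp add: power2_sum)
qed

lemma jointly_gaussian_variance:
  assumes lin: "\<And>a b. centered_gaussian M (\<lambda>\<omega>. a * Y \<omega> + b * Z \<omega>)"
  shows "variance (\<lambda>\<omega>. a * Y \<omega> + b * Z \<omega>)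
    = a\<^sup>2 * variance Y + 2 * a * b * expectation (\<lambda>\<omega>. Y \<omega> * Z \<omega>) + b\<^sup>2 * variance Z"
proof -
  have Y: "centered_gaussian M Y" and Z: "centered_gaussian M Z"
    using lin[of 1 0] lin[of 0 1] by auto
  note [simp] = jointly_gaussian_integrable_mult[OF lin] centered_gaussian_moments(2)[OF Y] centered_gaussian_moments(2)[OF Z]
  have "variance (\<lambda>\<omega>. a * Y \<omega> + b * Z \<omega>) = expectation (\<lambda>\<omega>. (a * Y \<omega> + b * Z \<omega>)\<^sup>2)"
    by (rule centered_gaussian_moments(4)[OF lin])
  also have "\<dots> = expectation (\<lambda>\<omega>. a\<^sup>2 * (Y \<omega>)\<^sup>2 + 2 * a * b * (Y \<omega> * Z \<omega>) + b\<^sup>2 * (Z \<omega>)\<^sup>2)"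
    by (simp add: power2_eq_square algebra_simps)
  also have "\<dots> = a\<^sup>2 * variance Y + 2 * a * b * expectation (\<lambda>\<omega>. Y \<omega> * Z \<omega>) + b\<^sup>2 * variance Z"
    unfolding centered_gaussian_moments(4)[OF Y] centered_gaussian_moments(4)[OF Z] by simp
  finally show ?thesis .
qed

text \<open>Without the mixed term the variance of a Y + b Z is a sum, so the Gaussian
  characteristic function factors.\<close>

lemma jointly_gaussian_uncorrelated_imp_indep:
  assumes lin: "\<And>a b. centered_gaussian M (\<lambda>\<omega>. a * Y \<omega> + b * Z \<omega>)"
    and uncorr: "expectation (\<lambda>\<omega>. Y \<omega> * Z \<omega>) = 0"
  shows "indep_var borel Y borel Z"
proof (rule indep_var_if_char)
  have Y: "centered_gaussian M Y" and Z: "centered_gaussian M Z"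
    using lin[of 1 0] lin[of 0 1] by auto
  then show [measurable]: "Y \<in> borel_measurable M" "Z \<in> borel_measurable M"
    by (auto simp: centered_gaussian_def)
  fix a b :: real
  have *: "(CLINT \<omega>|M. iexp (t * W \<omega>)) = exp (- (t\<^sup>2 * variance W) / 2)"
    if W: "centered_gaussian M W" for W t
  proof -
    have [measurable]: "W \<in> borel_measurable M" using W by (simp add: centered_gaussian_def)
    show ?thesis
      using centered_gaussian_char[OF W, of t] by (simp add: char_def integral_distr)
  qed
  have "(CLINT \<omega>|M. iexp (a * Y \<omega> + b * Z \<omega>)) = exp (- (a\<^sup>2 * variance Y + b\<^sup>2 * variance Z) / 2)"
    using *[OF lin[of a b], of 1] unfolding jointly_gaussian_variance[OF lin] uncorr
    by (simp only: mult_1_left one_power2) simp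
  also have "\<dots> = (CLINT \<omega>|M. iexp (a * Y \<omega>)) * (CLINT \<omega>|M. iexp (b * Z \<omega>))"
    unfolding *[OF Y] *[OF Z] of_real_mult[symmetric] exp_add[symmetric]
    by (simp add: add_divide_distrib)
  finally show "(CLINT \<omega>|M. iexp (a * Y \<omega> + b * Z \<omega>)) = (CLINT \<omega>|M. iexp (a * Y \<omega>)) * (CLINT \<omega>|M. iexp (b * Z \<omega>))" .
qed

text \<open>Regression: V = r U + Z with Z uncorrelated to U, hence independent of it. For a fixed
  value x of U the variable V is normal with mean r x and variance 1 - r^2, and the density
  comparison on the bounded sets is integrated over the law of U.\<close>

lemma gaussian_pair_bounded_sets_prob_le:
  assumes lin: "\<And>a b. centered_gaussian M (\<lambda>\<omega>. a * U \<omega> + b * V \<omega>)"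
    and var: "variance U = 1" "variance V = 1"
    and r: "expectation (\<lambda>\<omega>. U \<omega> * V \<omega>) = r" "\<bar>r\<bar> < 1"
    and I: "I \<in> sets borel" "I \<subseteq> {0..P}" and J: "J \<in> sets borel" "J \<subseteq> {0..Q}"
  shows "prob {\<omega> \<in> space M. U \<omega> \<in> I \<and> V \<omega> \<in> J}
    \<le> exp (\<bar>r\<bar> * P * Q / (1 - r\<^sup>2)) / sqrt (1 - r\<^sup>2)
        * (prob {\<omega> \<in> space M. U \<omega> \<in> I} * prob {\<omega> \<in> space M. V \<omega> \<in> J})"
proof -
  note [measurable] = I(1) J(1)
  define C where "C = exp (\<bar>r\<bar> * P * Q / (1 - r\<^sup>2)) / sqrt (1 - r\<^sup>2)"
  have r2: "1 - r\<^sup>2 > 0" using r(2) by (simp add: abs_square_less_1)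
  then have C: "C \<ge> 0" by (simp add: C_def)
  define Z where "Z = (\<lambda>\<omega>. V \<omega> - r * U \<omega>)"
  have U: "centered_gaussian M U" and V: "centered_gaussian M V" and Z: "centered_gaussian M Z"
    using lin[of 1 0] lin[of 0 1] lin[of "- r" 1] by (auto simp: Z_def)
  then have [measurable]: "U \<in> borel_measurable M" "V \<in> borel_measurable M" "Z \<in> borel_measurable M"
    by (auto simp: centered_gaussian_def)
  have "variance Z = 1 - r\<^sup>2"
    using jointly_gaussian_variance[OF lin, of "- r" 1] var r(1) by (simp add: Z_def power2_eq_square)
  then have DZ: "distributed M lborel Z (\<lambda>x. ennreal (normal_density 0 (sqrt (1 - r\<^sup>2)) x))"
    using centered_gaussian_variance_pos[OF Z] r2 by simp
  have DV: "distributed M lborel V (\<lambda>x. ennreal (normal_density 0 1 x))"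
    using centered_gaussian_variance_pos[OF V] var by simp
  have indep: "indep_var borel U borel Z"
  proof (rule jointly_gaussian_uncorrelated_imp_indep)
    fix a b
    show "centered_gaussian M (\<lambda>\<omega>. a * U \<omega> + b * Z \<omega>)"
      using lin[of "a - b * r" b] by (simp add: Z_def algebra_simps)
    have "expectation (\<lambda>\<omega>. U \<omega> * Z \<omega>) = expectation (\<lambda>\<omega>. U \<omega> * V \<omega> - r * (U \<omega>)\<^sup>2)"
      by (simp add: Z_def algebra_simps power2_eq_square)
    also have "\<dots> = r - r * variance U"
      unfolding centered_gaussian_moments(4)[OF U]
      using jointly_gaussian_integrable_mult[OF lin] centered_gaussian_moments(2)[OF U] r(1) by simp
    finally show "expectation (\<lambda>\<omega>. U \<omega> * Z \<omega>) = 0" using var by simp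
  qed
  interpret PU: prob_space "distr M borel U" by (rule prob_space_distr) simp
  interpret PZ: prob_space "distr M borel Z" by (rule prob_space_distr) simp
  \<comment> \<open>The joint event in the coordinates (U, Z), where the law is a product and can be
    integrated slice by slice.\<close>
  define S where "S = {(x, z). x \<in> I \<and> r * x + z \<in> J}"
  have S[measurable]: "S \<in> sets (borel \<Otimes>\<^sub>M borel)"
  proof -
    have "S = {w \<in> space (borel \<Otimes>\<^sub>M borel). fst w \<in> I \<and> r * fst w + snd w \<in> J}"
      by (auto simp: S_def space_pair_measure)
    also have "\<dots> \<in> sets (borel \<Otimes>\<^sub>M borel)" by measurable
    finally show ?thesis .
  qed
  have slice: "emeasure (distr M borel Z) (Pair x -` S) \<le> ennreal (C * prob {\<omega> \<in> space M. V \<omega> \<in> J}) * indicator I x" for x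
  proof (cases "x \<in> I")
    case True
    with I have x: "0 \<le> x" "x \<le> P" by auto
    have D: "distributed M lborel (\<lambda>\<omega>. r * x + Z \<omega>) (\<lambda>y. ennreal (normal_density (r * x) (sqrt (1 - r\<^sup>2)) y))"
      using normal_density_affine[OF DZ, of 1 "r * x"] r2 by simp
    have "Pair x -` S = {z. r * x + z \<in> J}" using True by (auto simp: S_def)
    then have "emeasure (distr M borel Z) (Pair x -` S) = emeasure M (Z -` {z. r * x + z \<in> J} \<inter> space M)"
      by (simp add: emeasure_distr)
    also have "Z -` {z. r * x + z \<in> J} \<inter> space M = (\<lambda>\<omega>. r * x + Z \<omega>) -` J \<inter> space M" by auto
    also have "emeasure M \<dots> = (\<integral>\<^sup>+y. ennreal (normal_density (r * x) (sqrt (1 - r\<^sup>2)) y) * indicator J y \<partial>lborel)"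
      by (rule distributed_emeasure[OF D]) simp
    also have "\<dots> \<le> (\<integral>\<^sup>+y. ennreal C * (ennreal (normal_density 0 1 y) * indicator J y) \<partial>lborel)"
    proof (rule nn_integral_mono)
      fix y
      show "ennreal (normal_density (r * x) (sqrt (1 - r\<^sup>2)) y) * indicator J y
          \<le> ennreal C * (ennreal (normal_density 0 1 y) * indicator J y)"
        using normal_density_conditional_le[OF r(2) x, of y Q] J C
        by (auto split: split_indicator simp: ennreal_mult[symmetric] C_def intro!: ennreal_leI)
    qed
    also have "\<dots> = ennreal C * emeasure M (V -` J \<inter> space M)"
      by (subst nn_integral_cmult) (auto simp: distributed_emeasure[OF DV])
    also have "V -` J \<inter> space M = {\<omega> \<in> space M. V \<omega> \<in> J}" by auto
    finally show ?thesis
      using True C by (simp add: emeasure_eq_measure ennreal_mult)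
  qed (auto simp: S_def)
  have "emeasure M {\<omega> \<in> space M. U \<omega> \<in> I \<and> V \<omega> \<in> J}
      = emeasure (distr M (borel \<Otimes>\<^sub>M borel) (\<lambda>\<omega>. (U \<omega>, Z \<omega>))) S"
  proof -
    have "(\<lambda>\<omega>. (U \<omega>, Z \<omega>)) -` S \<inter> space M = {\<omega> \<in> space M. U \<omega> \<in> I \<and> V \<omega> \<in> J}"
      by (auto simp: S_def Z_def)
    then show ?thesis by (simp add: emeasure_distr)
  qed
  also have "\<dots> = emeasure (distr M borel U \<Otimes>\<^sub>M distr M borel Z) S"
    using indep by (simp add: indep_var_distribution_eq)
  also have "\<dots> = (\<integral>\<^sup>+x. emeasure (distr M borel Z) (Pair x -` S) \<partial>distr M borel U)"
    by (rule PZ.emeasure_pair_measure_alt) simp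
  also have "\<dots> \<le> (\<integral>\<^sup>+x. ennreal (C * prob {\<omega> \<in> space M. V \<omega> \<in> J}) * indicator I x \<partial>distr M borel U)"
    by (intro nn_integral_mono slice)
  also have "\<dots> = ennreal (C * prob {\<omega> \<in> space M. V \<omega> \<in> J}) * emeasure M (U -` I \<inter> space M)"
    by (subst nn_integral_cmult_indicator) (auto simp: emeasure_distr)
  also have "U -` I \<inter> space M = {\<omega> \<in> space M. U \<omega> \<in> I}" by auto
  finally have "emeasure M {\<omega> \<in> space M. U \<omega> \<in> I \<and> V \<omega> \<in> J}
      \<le> ennreal (C * (prob {\<omega> \<in> space M. U \<omega> \<in> I} * prob {\<omega> \<in> space M. V \<omega> \<in> J}))"
    using C by (simp add: emeasure_eq_measure ennreal_mult[symmetric] mult_ac)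
  then have "prob {\<omega> \<in> space M. U \<omega> \<in> I \<and> V \<omega> \<in> J}
      \<le> C * (prob {\<omega> \<in> space M. U \<omega> \<in> I} * prob {\<omega> \<in> space M. V \<omega> \<in> J})"
    using C by (simp add: emeasure_eq_measure)
  then show ?thesis by (simp add: C_def)
qed

text \<open>Let S count the events in a block with large expected number \<mu>. Its second moment is
  at most \<mu> + (1 + \<delta>/2) \<mu>^2, so by Chebyshev S = 0 has probability at most 1/\<mu> +
  \<delta>/2. Hence the probability that no event occurs from N on is below every \<delta>.\<close>

lemma borel_cantelli_second_moment:
  assumes A[measurable]: "\<And>n. A n \<in> events"
    and diverges: "\<not> summable (\<lambda>n. prob (A n))"
    and quasi: "\<And>\<delta>. \<delta> > 0 \<Longrightarrow> \<exists>N::nat. \<forall>i\<ge>N. \<forall>j\<ge>N. i \<noteq> j \<longrightarrow> prob (A i \<inter> A j) \<le> (1 + \<delta>) * (prob (A i) * prob (A j))"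
  shows "AE \<omega> in M. \<exists>\<^sub>\<infinity>n. \<omega> \<in> A n"
proof -
  have small: "prob (space M - (\<Union>n\<in>{N..}. A n)) \<le> \<delta>" if \<delta>: "\<delta> > 0" for N \<delta>
  proof -
    obtain N' where N': "\<And>i j. i \<ge> N' \<Longrightarrow> j \<ge> N' \<Longrightarrow> i \<noteq> j \<Longrightarrow> prob (A i \<inter> A j) \<le> (1 + \<delta> / 2) * (prob (A i) * prob (A j))"
      using quasi[of "\<delta> / 2"] \<delta> by auto
    \<comment> \<open>The block must lie beyond N, to count only late events, and beyond N', where
      quasi-independence holds.\<close>
    define L where "L = max N N'"
    have "\<not> summable (\<lambda>n. prob (A (n + L)))" using diverges summable_iff_shift[of "\<lambda>n. prob (A n)" L] by simp
    then have "\<exists>m. \<not> (\<Sum>n\<le>m. prob (A (n + L))) \<le> 2 / \<delta>"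
      using bounded_imp_summable[of "\<lambda>n. prob (A (n + L))" "2 / \<delta>"] by auto
    then obtain m where m: "2 / \<delta> < (\<Sum>n<m. prob (A (n + L)))"
      by (metis lessThan_Suc_atMost not_le)
    define T where "T = {L..<m + L}"
    define \<mu> where "\<mu> = (\<Sum>n\<in>T. prob (A n))"
    have \<mu>: "2 / \<delta> < \<mu>"
      using m by (simp add: \<mu>_def T_def sum.atLeastLessThan_shift_0 atLeast0LessThan add.commute)
    then have "\<mu> > 0" using \<delta> by (smt (verit) divide_pos_pos)
    define S :: "'a \<Rightarrow> real" where "S \<omega> = (\<Sum>n\<in>T. indicator (A n) \<omega>)" for \<omega>
    have [measurable]: "S \<in> borel_measurable M" unfolding S_def by measurable
    have fin: "finite T" by (simp add: T_def)
    have S_bd: "0 \<le> S \<omega>" "S \<omega> \<le> real (card T)" for \<omega>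
    proof -
      show "0 \<le> S \<omega>" by (auto simp: S_def intro: sum_nonneg)
      have "S \<omega> \<le> (\<Sum>n\<in>T. 1)" unfolding S_def by (intro sum_mono) (auto split: split_indicator)
      then show "S \<omega> \<le> real (card T)" by simp
    qed
    have intS: "integrable M S" using S_bd by (intro integrable_const_bound[of _ "real (card T)"]) auto
    have intS2: "integrable M (\<lambda>\<omega>. (S \<omega>)\<^sup>2)"
      using S_bd by (intro integrable_const_bound[of _ "(real (card T))\<^sup>2"]) (auto intro!: power_mono)
    have ES: "expectation S = \<mu>"
      unfolding S_def \<mu>_def
      by (subst Bochner_Integration.integral_sum) (auto intro!: integrable_real_indicator simp: emeasure_eq_measure)
    have "expectation (\<lambda>\<omega>. (S \<omega>)\<^sup>2) = expectation (\<lambda>\<omega>. \<Sum>i\<in>T. \<Sum>j\<in>T. indicator (A i \<inter> A j) \<omega>)"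
      by (simp add: S_def power2_eq_square sum_product indicator_inter_arith)
    also have "\<dots> = (\<Sum>i\<in>T. \<Sum>j\<in>T. prob (A i \<inter> A j))"
      by (subst Bochner_Integration.integral_sum, force intro!: Bochner_Integration.integrable_sum integrable_real_indicator simp: emeasure_eq_measure,
          subst Bochner_Integration.integral_sum) (auto intro!: integrable_real_indicator simp: emeasure_eq_measure)
    \<comment> \<open>Quasi-independence says nothing about i = j, so the diagonal pays
      \<open>prob (A i)\<close>. Granting it the product term as well lets the double sum close to
      \<mu>^2.\<close>
    also have "\<dots> \<le> (\<Sum>i\<in>T. \<Sum>j\<in>T. (if i = j then prob (A i) else 0) + (1 + \<delta> / 2) * (prob (A i) * prob (A j)))"
      using \<delta> N' by (intro sum_mono) (auto simp: T_def L_def)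
    also have "\<dots> = \<mu> + (1 + \<delta> / 2) * \<mu>\<^sup>2"
    proof -
      have "(\<Sum>i\<in>T. \<Sum>j\<in>T. (1 + \<delta> / 2) * (prob (A i) * prob (A j)))
          = (1 + \<delta> / 2) * (\<Sum>i\<in>T. \<Sum>j\<in>T. prob (A i) * prob (A j))"
        by (simp add: sum_distrib_left)
      also have "\<dots> = (1 + \<delta> / 2) * \<mu>\<^sup>2"
        by (simp add: \<mu>_def power2_eq_square sum_product)
      finally show ?thesis using fin by (simp add: sum.distrib \<mu>_def)
    qed
    finally have ES2: "expectation (\<lambda>\<omega>. (S \<omega>)\<^sup>2) \<le> \<mu> + (1 + \<delta> / 2) * \<mu>\<^sup>2" .
    have "variance S = expectation (\<lambda>\<omega>. (S \<omega>)\<^sup>2) - \<mu>\<^sup>2"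
      using variance_eq[OF intS intS2] by (simp add: ES)
    with ES2 have var: "variance S \<le> \<mu> + \<delta> / 2 * \<mu>\<^sup>2" by (simp add: algebra_simps)
    have "prob (space M - (\<Union>n\<in>{N..}. A n)) \<le> prob {\<omega> \<in> space M. \<mu> \<le> \<bar>S \<omega> - expectation S\<bar>}"
    proof (rule finite_measure_mono)
      show "space M - (\<Union>n\<in>{N..}. A n) \<subseteq> {\<omega> \<in> space M. \<mu> \<le> \<bar>S \<omega> - expectation S\<bar>}"
      proof
        fix \<omega> assume \<omega>: "\<omega> \<in> space M - (\<Union>n\<in>{N..}. A n)"
        then have "S \<omega> = 0" unfolding S_def by (intro sum.neutral) (auto simp: T_def L_def)
        with \<omega> show "\<omega> \<in> {\<omega> \<in> space M. \<mu> \<le> \<bar>S \<omega> - expectation S\<bar>}" by (simp add: ES)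
      qed
    qed measurable
    also have "\<dots> \<le> variance S / \<mu>\<^sup>2"
      by (rule Chebyshev_inequality) (use intS2 \<open>\<mu> > 0\<close> in auto)
    also have "\<dots> \<le> (\<mu> + \<delta> / 2 * \<mu>\<^sup>2) / \<mu>\<^sup>2" using var by (intro divide_right_mono) auto
    also have "\<dots> = 1 / \<mu> + \<delta> / 2" using \<open>\<mu> > 0\<close> by (simp add: field_simps power2_eq_square)
    also have "\<dots> \<le> \<delta>" using \<mu> \<open>\<mu> > 0\<close> \<delta> by (simp add: field_simps)
    finally show ?thesis .
  qed
  have "AE \<omega> in M. \<omega> \<in> (\<Union>n\<in>{N..}. A n)" for N
  proof -
    have "prob (space M - (\<Union>n\<in>{N..}. A n)) \<le> 0"
      by (rule field_le_epsilon) (use small in auto)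
    then have "prob (space M - (\<Union>n\<in>{N..}. A n)) = 0" by (simp add: measure_le_0_iff)
    then have "AE \<omega> in M. \<omega> \<notin> space M - (\<Union>n\<in>{N..}. A n)"
      by (subst (asm) prob_eq_0) auto
    then show ?thesis by (auto elim: AE_mp)
  qed
  then have "AE \<omega> in M. \<forall>N. \<omega> \<in> (\<Union>n\<in>{N..}. A n)" by (simp add: AE_all_countable)
  then show ?thesis
    by eventually_elim (auto simp: INFM_nat_le)
qed

end

section \<open>The variance function\<close>

text \<open>A monotone derivative at t lies between its values at mean value points in (t/2, t) and
  (t, 2t). Those values are difference quotients of \<open>f\<close> over lengths t/2 and t, hence
  of order t powr (p - 1).\<close>

lemma ultimately_monotone_deriv_bound:
  fixes f :: "real \<Rightarrow> real"
  assumes diff: "\<And>t. t > 0 \<Longrightarrow> f differentiable (at t)"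
    and mono: "ultimately_monotone (deriv f)"
    and bd: "\<And>t. t \<ge> T \<Longrightarrow> \<bar>f t\<bar> \<le> C * t powr p"
  shows "\<exists>C' T'. \<forall>t\<ge>T'. \<bar>deriv f t\<bar> \<le> C' * t powr (p - 1)"
proof -
  obtain K where K: "K > 0" "mono_on {K<..} (deriv f) \<or> antimono_on {K<..} (deriv f)"
    using mono by (auto simp: ultimately_monotone_def)
  define T' where "T' = max (2 * T) (max T (2 * K + 1))"
  \<comment> \<open>The coefficients come from 2 |f t - f (t/2)| + |f (2t) - f t| <= 3 |f t| + 2 |f
    (t/2)| + |f (2t)|.\<close>
  define C' where "C' = C * (3 + 2 * (1/2) powr p + 2 powr p)"
  have "\<bar>deriv f t\<bar> \<le> C' * t powr (p - 1)" if t: "t \<ge> T'" for t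
  proof -
    have t': "t > 0" "t / 2 > K" "t / 2 \<ge> T" "t \<ge> T" "2 * t \<ge> T" using t K(1) by (auto simp: T'_def)
    have der: "(f has_real_derivative deriv f x) (at x)" if "x > 0" for x
      using diff[OF that] by (simp add: DERIV_deriv_iff_real_differentiable)
    obtain x where x: "t / 2 < x" "x < t" "f t - f (t / 2) = (t - t / 2) * deriv f x"
      using MVT2[of "t / 2" t f "deriv f"] der t' by auto
    obtain y where y: "t < y" "y < 2 * t" "f (2 * t) - f t = (2 * t - t) * deriv f y"
      using MVT2[of t "2 * t" f "deriv f"] der t' by auto
    have "\<bar>deriv f t\<bar> \<le> \<bar>deriv f x\<bar> + \<bar>deriv f y\<bar>"
      using K(2)
    proof
      assume "mono_on {K<..} (deriv f)"
      then have "deriv f x \<le> deriv f t" "deriv f t \<le> deriv f y"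
        using x y t' by (auto intro!: mono_onD[of "{K<..}" "deriv f"])
      then show ?thesis by linarith
    next
      assume "antimono_on {K<..} (deriv f)"
      then have "deriv f t \<le> deriv f x" "deriv f y \<le> deriv f t"
        using x y t' by (auto intro: monotone_onD)
      then show ?thesis by linarith
    qed
    then have "t * \<bar>deriv f t\<bar> \<le> t * \<bar>deriv f x\<bar> + t * \<bar>deriv f y\<bar>"
      using t' by (simp add: distrib_left[symmetric])
    also have "t * \<bar>deriv f x\<bar> = \<bar>t * deriv f x\<bar>" using t' by (simp add: abs_mult)
    also have "t * deriv f x = 2 * (f t - f (t / 2))" using x(3) by simp
    also have "\<bar>\<dots>\<bar> = 2 * \<bar>f t - f (t / 2)\<bar>" by (subst abs_mult) simp
    also have "t * \<bar>deriv f y\<bar> = \<bar>t * deriv f y\<bar>" using t' by (simp add: abs_mult)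
    also have "t * deriv f y = f (2 * t) - f t" using y(3) by simp
    also have "2 * \<bar>f t - f (t / 2)\<bar> + \<bar>f (2 * t) - f t\<bar> \<le> 3 * \<bar>f t\<bar> + 2 * \<bar>f (t / 2)\<bar> + \<bar>f (2 * t)\<bar>"
      using abs_triangle_ineq4[of "f t" "f (t / 2)"] abs_triangle_ineq4[of "f (2 * t)" "f t"] by linarith
    also have "\<dots> \<le> 3 * (C * t powr p) + 2 * (C * (t / 2) powr p) + C * (2 * t) powr p"
      using bd[of t] bd[of "t / 2"] bd[of "2 * t"] t' by linarith
    also have "\<dots> = C' * t powr p"
      using t' by (simp add: C'_def powr_mult powr_divide algebra_simps)
    finally have "\<bar>deriv f t\<bar> \<le> C' * t powr p / t"
      using t' by (simp add: pos_le_divide_eq mult.commute)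
    then show ?thesis
      using t' by (simp add: powr_diff)
  qed
  then show ?thesis by blast
qed

text \<open>Mean value theorem twice: for the difference of \<open>v\<close> over the step k, then
  for \<open>deriv v\<close> between x and x + k. All points used lie to the right of a.\<close>

lemma second_difference_bound:
  fixes v :: "real \<Rightarrow> real"
  assumes v: "\<And>t. t > 0 \<Longrightarrow> v differentiable (at t)" "\<And>t. t > 0 \<Longrightarrow> deriv v differentiable (at t)"
    and bd: "\<And>t. t \<ge> a \<Longrightarrow> \<bar>deriv (deriv v) t\<bar> \<le> B"
    and pos: "a > 0" "h > 0" "k > 0"
  shows "\<bar>v (a + h + k) - v (a + h) - v (a + k) + v a\<bar> \<le> h * k * B"
proof -
  have der: "(v has_real_derivative deriv v x) (at x)" if "x > 0" for x
    using v(1)[OF that] by (simp add: DERIV_deriv_iff_real_differentiable)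
  have der2: "(deriv v has_real_derivative deriv (deriv v) x) (at x)" if "x > 0" for x
    using v(2)[OF that] by (simp add: DERIV_deriv_iff_real_differentiable)
  define g where "g x = v (x + k) - v x" for x
  have "(g has_real_derivative deriv v (x + k) - deriv v x) (at x)" if "x > 0" for x
    unfolding g_def using pos that
    by (intro DERIV_diff der) (simp_all add: DERIV_shift[symmetric] der)
  then obtain x where x: "a < x" "x < a + h" "g (a + h) - g a = (a + h - a) * (deriv v (x + k) - deriv v x)"
    using MVT2[of a "a + h" g "\<lambda>x. deriv v (x + k) - deriv v x"] pos by auto
  obtain y where y: "x < y" "y < x + k" "deriv v (x + k) - deriv v x = (x + k - x) * deriv (deriv v) y"
    using MVT2[of x "x + k" "deriv v" "deriv (deriv v)"] der2 pos x by auto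
  have "v (a + h + k) - v (a + h) - v (a + k) + v a = h * k * deriv (deriv v) y"
    using x(3) y(3) by (simp add: g_def)
  moreover have "\<bar>deriv (deriv v) y\<bar> \<le> B" using bd[of y] x y by auto
  ultimately show ?thesis using pos by (simp add: abs_mult)
qed

text \<open>Applying the monotone derivative bound to \<open>v\<close> and then to
  \<open>deriv v\<close> lowers the exponent from 2 \<alpha> to 2 \<alpha> - 2. This is negative, so
  the bound at a dominates all later points.\<close>

lemma AI_second_difference:
  assumes "assumption_AI v A \<alpha>"
  obtains C T where "C > 0" "T > 0"
    "\<And>a h k. a \<ge> T \<Longrightarrow> h > 0 \<Longrightarrow> k > 0 \<Longrightarrow>
       \<bar>v (a + h + k) - v (a + h) - v (a + k) + v a\<bar> \<le> C * h * k * a powr (2 * \<alpha> - 2)"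
proof -
  have A: "A > 0" "0 < \<alpha>" "\<alpha> < 1" and lim: "((\<lambda>t. v t / t powr (2 * \<alpha>)) \<longlongrightarrow> A) at_top"
    and pos: "\<And>t. t > 0 \<Longrightarrow> v t > 0"
    and d: "\<And>t. t > 0 \<Longrightarrow> v differentiable (at t)" "\<And>t. t > 0 \<Longrightarrow> deriv v differentiable (at t)"
    and m: "ultimately_monotone (deriv v)" "ultimately_monotone (deriv (deriv v))"
    using assms by (auto simp: assumption_AI_def twice_continuously_differentiable_pos_def)
  have "eventually (\<lambda>t. v t / t powr (2 * \<alpha>) < 2 * A) at_top"
    using order_tendstoD(2)[OF lim, of "2 * A"] A by simp
  then obtain T0 where T0: "\<And>t. t \<ge> T0 \<Longrightarrow> v t / t powr (2 * \<alpha>) < 2 * A"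
    by (auto simp: eventually_at_top_linorder)
  have "\<bar>v t\<bar> \<le> 2 * A * t powr (2 * \<alpha>)" if "t \<ge> max T0 1" for t
    using T0[of t] pos[of t] that by (simp add: field_simps)
  from ultimately_monotone_deriv_bound[OF d(1) m(1) this]
  obtain C1 T1 where "\<And>t. t \<ge> T1 \<Longrightarrow> \<bar>deriv v t\<bar> \<le> C1 * t powr (2 * \<alpha> - 1)" by blast
  from ultimately_monotone_deriv_bound[OF d(2) m(2) this]
  obtain C2 T2 where C2: "\<And>t. t \<ge> T2 \<Longrightarrow> \<bar>deriv (deriv v) t\<bar> \<le> C2 * t powr (2 * \<alpha> - 1 - 1)" by blast
  show ?thesis
  proof
    show "\<bar>C2\<bar> + 1 > 0" "max T2 1 > 0" by auto
    fix a h k :: real assume *: "a \<ge> max T2 1" "h > 0" "k > 0"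
    have "\<bar>v (a + h + k) - v (a + h) - v (a + k) + v a\<bar> \<le> h * k * ((\<bar>C2\<bar> + 1) * a powr (2 * \<alpha> - 2))"
    proof (rule second_difference_bound[OF d])
      fix t assume "a \<le> t"
      then have "\<bar>deriv (deriv v) t\<bar> \<le> C2 * t powr (2 * \<alpha> - 2)" using C2[of t] * by simp
      also have "\<dots> \<le> (\<bar>C2\<bar> + 1) * a powr (2 * \<alpha> - 2)"
        using * \<open>a \<le> t\<close> A by (intro mult_mono powr_mono2') auto
      finally show "\<bar>deriv (deriv v) t\<bar> \<le> (\<bar>C2\<bar> + 1) * a powr (2 * \<alpha> - 2)" .
    qed (use * in auto)
    then show "\<bar>v (a + h + k) - v (a + h) - v (a + k) + v a\<bar> \<le> (\<bar>C2\<bar> + 1) * h * k * a powr (2 * \<alpha> - 2)"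
      by (simp add: mult_ac)
  qed
qed

section \<open>The constant \<open>storage_const\<close> and the minimal exponent\<close>

lemma powr_squared: "(x powr a)\<^sup>2 = (x::real) powr (2 * a)"
  by (simp add: power2_eq_square flip: powr_add)

lemma storage_const_pos: "c > 0 \<Longrightarrow> 0 < \<alpha> \<Longrightarrow> \<alpha> < 1 \<Longrightarrow> storage_const c \<alpha> > 0"
  by (simp add: storage_const_def)

text \<open>Young's inequality with weights 1 - \<alpha> and \<alpha> for u / (1 - \<alpha>) and c
  \<tau> / \<alpha>, normalized so that their weighted mean is u + c \<tau>. Thus
  \<open>storage_const\<close> is a lower bound for (u + c \<tau>) / (u powr (1 - \<alpha>) * \<tau>
  powr \<alpha>).\<close>

lemma storage_const_le:
  assumes "c > 0" "0 < \<alpha>" "\<alpha> < 1" "u > 0" "\<tau> > 0"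
  shows "storage_const c \<alpha> * u powr (1 - \<alpha>) * \<tau> powr \<alpha> \<le> u + c * \<tau>"
proof -
  define a b where "a = u / (1 - \<alpha>)" and "b = c * \<tau> / \<alpha>"
  have ab: "a > 0" "b > 0" using assms by (simp_all add: a_def b_def)
  have "a powr (1 - \<alpha>) * b powr \<alpha> \<le> (1 - \<alpha>) * a + \<alpha> * b"
    using assms ab by (intro Youngs_inequality_0) auto
  also have "\<dots> = u + c * \<tau>" using assms by (simp add: a_def b_def)
  also have "a powr (1 - \<alpha>) * b powr \<alpha> = storage_const c \<alpha> * u powr (1 - \<alpha>) * \<tau> powr \<alpha>"
  proof -
    have "storage_const c \<alpha> = (c / \<alpha>) powr \<alpha> * ((1 - \<alpha>) powr \<alpha> / (1 - \<alpha>))"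
    proof -
      have "(\<alpha> / (c * (1 - \<alpha>))) powr - \<alpha> = (c / \<alpha> * (1 - \<alpha>)) powr \<alpha>"
      proof -
        have eq: "c / \<alpha> * (1 - \<alpha>) = inverse (\<alpha> / (c * (1 - \<alpha>)))" by simp
        show ?thesis unfolding eq using assms by (subst inverse_powr) (auto simp: powr_minus)
      qed
      also have "\<dots> = (c / \<alpha>) powr \<alpha> * (1 - \<alpha>) powr \<alpha>"
        using assms by (subst powr_mult) auto
      finally show ?thesis by (simp add: storage_const_def)
    qed
    also have "(1 - \<alpha>) powr \<alpha> / (1 - \<alpha>) = 1 / (1 - \<alpha>) powr (1 - \<alpha>)"
    proof -
      have "(1 - \<alpha>) powr \<alpha> * (1 - \<alpha>) powr (1 - \<alpha>) = 1 - \<alpha>"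
        unfolding powr_add[symmetric] using assms by simp
      then show ?thesis using assms by (simp add: field_simps)
    qed
    finally have sc: "storage_const c \<alpha> = (c / \<alpha>) powr \<alpha> * (1 / (1 - \<alpha>) powr (1 - \<alpha>))" .
    have "a powr (1 - \<alpha>) = u powr (1 - \<alpha>) / (1 - \<alpha>) powr (1 - \<alpha>)"
      unfolding a_def using assms by (simp add: powr_divide)
    moreover have "b powr \<alpha> = (c / \<alpha>) powr \<alpha> * \<tau> powr \<alpha>"
      unfolding b_def using assms powr_mult[of "c / \<alpha>" \<tau> \<alpha>] by simp
    ultimately show ?thesis by (simp add: sc)
  qed
  finally show ?thesis .
qed

text \<open>Equality case of Young's inequality: this \<tau> makes u / (1 - \<alpha>) and c \<tau> /
  \<alpha> coincide.\<close>

lemma storage_const_eq: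
  assumes "c > 0" "0 < \<alpha>" "\<alpha> < 1" "u > 0"
  defines "\<tau> \<equiv> \<alpha> / (c * (1 - \<alpha>)) * u"
  shows "storage_const c \<alpha> * u powr (1 - \<alpha>) * \<tau> powr \<alpha> = u + c * \<tau>"
proof -
  have "(\<alpha> / (c * (1 - \<alpha>))) powr - \<alpha> * (1 / (1 - \<alpha>)) * u powr (1 - \<alpha>) * (\<alpha> / (c * (1 - \<alpha>)) * u) powr \<alpha>
      = ((\<alpha> / (c * (1 - \<alpha>))) powr - \<alpha> * (\<alpha> / (c * (1 - \<alpha>))) powr \<alpha>) * (u powr (1 - \<alpha>) * u powr \<alpha>) / (1 - \<alpha>)"
    using assms(1-4) by (subst powr_mult) auto
  also have "\<dots> = u / (1 - \<alpha>)"
    unfolding powr_add[symmetric] using assms(1-4) by simp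
  finally have "storage_const c \<alpha> * u powr (1 - \<alpha>) * \<tau> powr \<alpha> = u / (1 - \<alpha>)"
    by (simp only: \<tau>_def storage_const_def)
  also have "\<dots> = u + c * \<tau>" using assms(1-4) by (simp add: \<tau>_def field_simps)
  finally show ?thesis .
qed

text \<open>Convergent sequences are bounded, so one constant serves all grid lengths, including the
  short ones on which the limit at infinity gives no information. The dyadic bound below rests on
  the same argument at 0.\<close>

lemma AI_nat_bound:
  assumes "assumption_AI v A \<alpha>"
  obtains C where "C > 0" "\<And>n::nat. n \<ge> 1 \<Longrightarrow> v (real n) \<le> C * real n powr (2 * \<alpha>)"
proof -
  have lim: "((\<lambda>t. v t / t powr (2 * \<alpha>)) \<longlongrightarrow> A) at_top"
    using assms by (auto simp: assumption_AI_def)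
  have "(\<lambda>n. v (real n) / real n powr (2 * \<alpha>)) \<longlonglongrightarrow> A"
    using filterlim_compose[OF lim filterlim_real_sequentially] .
  then have "Bseq (\<lambda>n. v (real n) / real n powr (2 * \<alpha>))"
    by (intro convergent_imp_Bseq convergentI)
  then obtain C where "C > 0" "\<And>n. norm (v (real n) / real n powr (2 * \<alpha>)) \<le> C"
    by (rule BseqE) blast
  then have "v (real n) \<le> C * real n powr (2 * \<alpha>)" if "n \<ge> 1" for n
    using that abs_le_D1[of "v (real n) / real n powr (2 * \<alpha>)" C] by (simp add: pos_divide_le_eq)
  with \<open>C > 0\<close> show ?thesis by (rule that)
qed

lemma AII_dyadic_bound:
  assumes "assumption_AII v A \<alpha>"
  obtains C where "C > 0" "\<And>m::nat. v (1 / 2 ^ m) \<le> C * (1 / 2 ^ m) powr (2 * \<alpha>)"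
proof -
  have lim: "((\<lambda>t. v t / t powr (2 * \<alpha>)) \<longlongrightarrow> A) (at_right 0)"
    using assms by (auto simp: assumption_AII_def)
  have "filterlim (\<lambda>m::nat. 1 / 2 ^ m :: real) (at_right 0) sequentially"
    by real_asymp
  then have "(\<lambda>m. v (1 / 2 ^ m) / (1 / 2 ^ m) powr (2 * \<alpha>)) \<longlonglongrightarrow> A"
    using filterlim_compose[OF lim] by blast
  then have "Bseq (\<lambda>m. v (1 / 2 ^ m) / (1 / 2 ^ m) powr (2 * \<alpha>))"
    by (intro convergent_imp_Bseq convergentI)
  then obtain C where C: "C > 0" "\<And>m. norm (v (1 / 2 ^ m) / (1 / 2 ^ m) powr (2 * \<alpha>)) \<le> C"
    by (rule BseqE) blast
  have "v (1 / 2 ^ m) \<le> C * (1 / 2 ^ m) powr (2 * \<alpha>)" for m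
    using abs_le_D1[OF C(2)[of m, unfolded real_norm_def]] by (simp add: pos_divide_le_eq)
  with \<open>C > 0\<close> show ?thesis by (rule that)
qed

text \<open>Uniformity in n needs two regimes. For n beyond T' the variance is close to its power
  law and Young's inequality applies. For smaller n it is bounded, and u^2 alone dominates u powr (2
  - 2 \<alpha>) once u is large.\<close>

lemma AI_exponent_lower:
  assumes AI: "assumption_AI v A \<alpha>" and c: "c > 0" and \<delta>: "\<delta> > 0"
  obtains U where "U > 0" "\<And>u n. u \<ge> U \<Longrightarrow> n \<ge> (1::nat) \<Longrightarrow>
    (storage_const c \<alpha>)\<^sup>2 / (A * (1 + \<delta>)) * u powr (2 - 2 * \<alpha>) \<le> (u + c * real n)\<^sup>2 / v (real n)"
proof -
  have A: "A > 0" "0 < \<alpha>" "\<alpha> < 1" and lim: "((\<lambda>t. v t / t powr (2 * \<alpha>)) \<longlongrightarrow> A) at_top"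
    and pos: "\<And>t. t > 0 \<Longrightarrow> v t > 0"
    using AI by (auto simp: assumption_AI_def)
  obtain C where C: "C > 0" "\<And>n::nat. n \<ge> 1 \<Longrightarrow> v (real n) \<le> C * real n powr (2 * \<alpha>)"
    using AI_nat_bound[OF AI] by blast
  have "eventually (\<lambda>t. v t / t powr (2 * \<alpha>) < A * (1 + \<delta>)) at_top"
    using order_tendstoD(2)[OF lim, of "A * (1 + \<delta>)"] A \<delta> by simp
  then obtain T where T: "\<And>t. t \<ge> T \<Longrightarrow> v t / t powr (2 * \<alpha>) < A * (1 + \<delta>)"
    by (auto simp: eventually_at_top_linorder)
  define T' where "T' = max T 1"
  define S where "S = (storage_const c \<alpha>)\<^sup>2 / (A * (1 + \<delta>))"
  have "filterlim (\<lambda>u::real. u powr (2 * \<alpha>)) at_top at_top" using A by real_asymp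
  then have "eventually (\<lambda>u::real. u powr (2 * \<alpha>) \<ge> S * (C * T' powr (2 * \<alpha>))) at_top"
    by (simp add: filterlim_at_top)
  then obtain U0 where U0: "\<And>u. u \<ge> U0 \<Longrightarrow> u powr (2 * \<alpha>) \<ge> S * (C * T' powr (2 * \<alpha>))"
    by (auto simp: eventually_at_top_linorder)
  show ?thesis
  proof
    show "max U0 1 > 0" by simp
    fix u :: real and n :: nat assume u: "u \<ge> max U0 1" and n: "n \<ge> 1"
    have "S * u powr (2 - 2 * \<alpha>) * v (real n) \<le> (u + c * real n)\<^sup>2"
    proof (cases "real n \<ge> T'")
      case True
      have "v (real n) \<le> A * (1 + \<delta>) * real n powr (2 * \<alpha>)"
        using T[of "real n"] True n by (simp add: T'_def pos_divide_less_eq)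
      then have "S * u powr (2 - 2 * \<alpha>) * v (real n) \<le> S * u powr (2 - 2 * \<alpha>) * (A * (1 + \<delta>) * real n powr (2 * \<alpha>))"
        using A \<delta> by (intro mult_left_mono) (auto simp: S_def)
      also have "\<dots> = (storage_const c \<alpha>)\<^sup>2 * u powr (2 - 2 * \<alpha>) * real n powr (2 * \<alpha>)"
        using A \<delta> by (simp add: S_def)
      also have "\<dots> = (storage_const c \<alpha> * u powr (1 - \<alpha>) * real n powr \<alpha>)\<^sup>2"
        by (simp add: power_mult_distrib powr_squared right_diff_distrib)
      also have "\<dots> \<le> (u + c * real n)\<^sup>2"
        using u n A c by (intro power_mono storage_const_le) (auto intro!: mult_nonneg_nonneg less_imp_le[OF storage_const_pos])
      finally show ?thesis .
    next
      case False
      have "v (real n) \<le> C * real n powr (2 * \<alpha>)" using C n by auto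
      also have "\<dots> \<le> C * T' powr (2 * \<alpha>)" using C(1) False A by (intro mult_left_mono powr_mono2) auto
      finally have "S * u powr (2 - 2 * \<alpha>) * v (real n) \<le> S * u powr (2 - 2 * \<alpha>) * (C * T' powr (2 * \<alpha>))"
        using A \<delta> by (intro mult_left_mono) (auto simp: S_def)
      also have "\<dots> = u powr (2 - 2 * \<alpha>) * (S * (C * T' powr (2 * \<alpha>)))" by simp
      also have "\<dots> \<le> u powr (2 - 2 * \<alpha>) * u powr (2 * \<alpha>)" using U0[of u] u by (intro mult_left_mono) auto
      also have "\<dots> = u\<^sup>2" using u by (simp add: powr_add[symmetric])
      also have "\<dots> \<le> (u + c * real n)\<^sup>2" using u c by (intro power_mono) auto
      finally show ?thesis .
    qed
    then show "(storage_const c \<alpha>)\<^sup>2 / (A * (1 + \<delta>)) * u powr (2 - 2 * \<alpha>) \<le> (u + c * real n)\<^sup>2 / v (real n)"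
      using pos[of "real n"] n by (simp add: pos_le_divide_eq S_def)
  qed
qed

text \<open>Complements the previous bound, which does not grow with n: keeping only c n in the
  numerator gives an exponent that makes the union bound over all grid lengths converge.\<close>

lemma AI_exponent_summable:
  assumes AI: "assumption_AI v A \<alpha>" and c: "c > 0"
  obtains \<kappa> where "\<kappa> > 0" "\<And>u n. u \<ge> 0 \<Longrightarrow> n \<ge> (1::nat) \<Longrightarrow>
    \<kappa> * real n powr (2 - 2 * \<alpha>) \<le> (u + c * real n)\<^sup>2 / v (real n)"
proof -
  have A: "0 < \<alpha>" "\<alpha> < 1" and pos: "\<And>t. t > 0 \<Longrightarrow> v t > 0"
    using AI by (auto simp: assumption_AI_def)
  obtain C where C: "C > 0" "\<And>n::nat. n \<ge> 1 \<Longrightarrow> v (real n) \<le> C * real n powr (2 * \<alpha>)"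
    using AI_nat_bound[OF AI] by blast
  show ?thesis
  proof
    show "c\<^sup>2 / C > 0" using c C by simp
    fix u :: real and n :: nat assume u: "u \<ge> 0" and n: "n \<ge> 1"
    have "c\<^sup>2 / C * real n powr (2 - 2 * \<alpha>) * v (real n)
        \<le> c\<^sup>2 / C * real n powr (2 - 2 * \<alpha>) * (C * real n powr (2 * \<alpha>))"
      using C n by (intro mult_left_mono) auto
    also have "\<dots> = c\<^sup>2 * (real n powr (2 - 2 * \<alpha>) * real n powr (2 * \<alpha>))" using C(1) by simp
    also have "\<dots> = (c * real n)\<^sup>2" using n by (simp add: powr_add[symmetric] power_mult_distrib)
    also have "\<dots> \<le> (u + c * real n)\<^sup>2" using u c by (intro power_mono) auto
    finally show "c\<^sup>2 / C * real n powr (2 - 2 * \<alpha>) \<le> (u + c * real n)\<^sup>2 / v (real n)"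
      using pos[of "real n"] n by (simp add: pos_le_divide_eq)
  qed
qed

text \<open>At the optimal length Young's inequality is an equality, so the only loss is the factor
  1 + \<delta> from comparing \<open>v\<close> with its power law.\<close>

lemma AI_exponent_upper:
  assumes AI: "assumption_AI v A \<alpha>" and c: "c > 0" and \<delta>: "\<delta> > 0"
  defines "\<tau> \<equiv> \<lambda>u. \<alpha> / (c * (1 - \<alpha>)) * u"
  shows "eventually (\<lambda>u. (u + c * \<tau> u)\<^sup>2 / v (\<tau> u)
    \<le> (1 + \<delta>) * ((storage_const c \<alpha>)\<^sup>2 / A) * u powr (2 - 2 * \<alpha>)) at_top"
proof -
  have A: "A > 0" "0 < \<alpha>" "\<alpha> < 1" and lim: "((\<lambda>t. v t / t powr (2 * \<alpha>)) \<longlongrightarrow> A) at_top"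
    and pos: "\<And>t. t > 0 \<Longrightarrow> v t > 0"
    using AI by (auto simp: assumption_AI_def)
  define k where "k = \<alpha> / (c * (1 - \<alpha>))"
  have k: "k > 0" using A c by (simp add: k_def)
  have "eventually (\<lambda>t. v t / t powr (2 * \<alpha>) > A / (1 + \<delta>)) at_top"
    using order_tendstoD(1)[OF lim, of "A / (1 + \<delta>)"] A \<delta> by (simp add: field_simps)
  moreover have "filterlim \<tau> at_top at_top"
    unfolding \<tau>_def k_def[symmetric] using k by real_asymp
  ultimately have "eventually (\<lambda>u. v (\<tau> u) / \<tau> u powr (2 * \<alpha>) > A / (1 + \<delta>)) at_top"
    by (rule eventually_compose_filterlim)
  then show ?thesis
    using eventually_gt_at_top[of 0]
  proof eventually_elim
    case (elim u)
    have t: "\<tau> u > 0" using mult_pos_pos[OF k elim(2)] by (simp add: \<tau>_def k_def)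
    have "(u + c * \<tau> u)\<^sup>2 = (storage_const c \<alpha> * u powr (1 - \<alpha>) * \<tau> u powr \<alpha>)\<^sup>2"
      using storage_const_eq[OF c A(2,3) elim(2)] by (simp add: \<tau>_def)
    also have "\<dots> = (storage_const c \<alpha>)\<^sup>2 * u powr (2 - 2 * \<alpha>) * \<tau> u powr (2 * \<alpha>)"
      by (simp add: power_mult_distrib powr_squared right_diff_distrib)
    also have "\<dots> \<le> (storage_const c \<alpha>)\<^sup>2 * u powr (2 - 2 * \<alpha>) * ((1 + \<delta>) / A * v (\<tau> u))"
      using elim t A \<delta> by (intro mult_left_mono) (auto simp: field_simps)
    finally show ?case
      using pos[OF t] by (simp add: pos_divide_le_eq mult_ac)
  qed
qed

section \<open>Increments and oscillations\<close>

lemma (in prob_space) prob_countable_UN_le: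
  fixes g :: "nat \<Rightarrow> real"
  assumes "\<And>i. A i \<in> events" "\<And>i. prob (A i) \<le> k * g i" "summable g"
  shows "prob (\<Union>i. A i) \<le> k * suminf g"
proof -
  have summ: "summable (\<lambda>i. k * g i)" using assms(3) by (rule summable_mult)
  have summ': "summable (\<lambda>i. prob (A i))"
    by (rule summable_comparison_test'[OF summ, of 0]) (use assms(2) in auto)
  have "prob (\<Union>i. A i) \<le> (\<Sum>i. prob (A i))"
    by (rule finite_measure_subadditive_countably[OF _ summ']) (use assms(1) in auto)
  also have "\<dots> \<le> (\<Sum>i. k * g i)" by (intro suminf_le assms summ summ')
  also have "\<dots> = k * suminf g" using assms(3) by (rule suminf_mult)
  finally show ?thesis .
qed

text \<open>Approximate r from below by q m = floor (r 2^m) / 2^m. Each refinement stays put or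
  moves by one cell of the next level, so the moves telescope to at most x times the sum of the
  weights; continuity gives the limit.\<close>

lemma dyadic_chaining:
  fixes f :: "real \<Rightarrow> real"
  assumes cont: "continuous_on UNIV f"
    and a: "summable a" "\<And>m. 0 \<le> a m"
    and step: "\<And>m j::nat. j < 2 ^ m \<Longrightarrow> \<bar>f (k + real (Suc j) / 2 ^ m) - f (k + real j / 2 ^ m)\<bar> \<le> x * a m"
    and x: "x \<ge> 0" and r: "0 \<le> r" "r \<le> 1"
  shows "\<bar>f (k + r) - f k\<bar> \<le> x * suminf a"
proof (cases "r = 1")
  \<comment> \<open>The endpoint 1 is not covered by cell indices below 2^m; it is reached from 0 by
    the single cell of level 0.\<close>
  case True
  have "\<bar>f (k + r) - f k\<bar> \<le> x * a 0"
    using step[of 0 0] True by simp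
  also have "a 0 \<le> suminf a"
    using sum_le_suminf[OF a(1), of "{0}"] a(2) by simp
  finally show ?thesis using x by (simp add: mult_left_mono)
next
  case False
  with r have r1: "r < 1" by simp
  define J where "J m = nat \<lfloor>r * 2 ^ m\<rfloor>" for m :: nat
  define q where "q m = real (J m) / 2 ^ m" for m
  have J: "real (J m) \<le> r * 2 ^ m" "r * 2 ^ m < real (J m) + 1" for m
    using r by (auto simp: J_def)
  have Jlt: "J m < 2 ^ m" for m
  proof -
    have "real (J m) < 1 * 2 ^ m"
      using r1 by (intro le_less_trans[OF J(1) mult_strict_right_mono]) auto
    then have "real (J m) < real (2 ^ m)" by (simp only: mult_1 of_nat_power of_nat_numeral)
    then show ?thesis by (simp only: of_nat_less_iff)
  qed
  have lim: "q \<longlonglongrightarrow> r"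
  proof (rule tendsto_sandwich[OF always_eventually always_eventually])
    have "r \<le> (real (J m) + 1) / 2 ^ m" for m
      using J(2)[of m] by (simp add: pos_le_divide_eq)
    then show "\<forall>m. r - 1 / 2 ^ m \<le> q m"
      by (auto simp: q_def add_divide_distrib algebra_simps)
    show "\<forall>m. q m \<le> r" using J(1) by (auto simp: q_def pos_divide_le_eq)
    show "(\<lambda>m. r - 1 / 2 ^ m) \<longlonglongrightarrow> r" by real_asymp
  qed auto
  have incr: "\<bar>f (k + q (Suc m)) - f (k + q m)\<bar> \<le> x * a (Suc m)" for m
  proof -
    have "real (J (Suc m)) < 2 * real (J m) + 2" "2 * real (J m) < real (J (Suc m)) + 1"
      using J[of m] J[of "Suc m"] by auto
    then consider "J (Suc m) = 2 * J m" | "J (Suc m) = Suc (2 * J m)" by linarith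
    then show ?thesis
    proof cases
      case 1
      then have "q (Suc m) = q m" by (simp add: q_def)
      then show ?thesis using x a(2)[of "Suc m"] by simp
    next
      case 2
      have "q m = real (2 * J m) / 2 ^ Suc m" by (simp add: q_def)
      moreover have "q (Suc m) = real (Suc (2 * J m)) / 2 ^ Suc m" by (simp add: q_def 2)
      moreover have "2 * J m < 2 ^ Suc m" using Jlt[of m] by simp
      ultimately show ?thesis using step[of "2 * J m" "Suc m"] by simp
    qed
  qed
  have "\<bar>f (k + q m) - f k\<bar> \<le> x * (\<Sum>i\<le>m. a i)" for m
  proof (induction m)
    case 0
    have "J 0 = 0" using Jlt[of 0] by simp
    then show ?case using x a(2)[of 0] by (simp add: q_def)
  next
    case (Suc m)
    then show ?case using incr[of m] by (simp add: algebra_simps)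
  qed
  moreover have "x * (\<Sum>i\<le>m. a i) \<le> x * suminf a" for m
    using x a by (intro mult_left_mono sum_le_suminf) auto
  ultimately have "\<bar>f (k + q m) - f k\<bar> \<le> x * suminf a" for m
    by (meson order_trans)
  moreover have "(\<lambda>m. \<bar>f (k + q m) - f k\<bar>) \<longlonglongrightarrow> \<bar>f (k + r) - f k\<bar>"
    using cont lim by (auto intro!: tendsto_intros simp: continuous_on_def intro: tendsto_compose
      continuous_on_tendsto_compose[of UNIV f])
  ultimately show ?thesis
    by (intro LIMSEQ_le_const2) auto
qed

section \<open>Covariances and oscillations of the process\<close>

locale gaussian_stationary_increments = prob_space M for M :: "'w measure" +
  fixes X :: "real \<Rightarrow> 'w \<Rightarrow> real"
  assumes gaussian: "centered_gaussian_process M X"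
    and stationary: "stationary_increments M X"
    and zero: "AE \<omega> in M. X 0 \<omega> = 0"
begin

abbreviation v :: "real \<Rightarrow> real" where "v \<equiv> variance_function M X"

lemma X_gaussian: "centered_gaussian M (X t)"
  using gaussian unfolding centered_gaussian_process_def
  by (elim allE[of _ "{t}"] allE[of _ "\<lambda>_. 1"]) simp

lemma X_measurable[measurable]: "X t \<in> borel_measurable M"
  using X_gaussian by (simp add: centered_gaussian_def)

lemma increments_jointly_gaussian:
  "centered_gaussian M (\<lambda>\<omega>. a * (X t \<omega> - X s \<omega>) + b * (X t' \<omega> - X s' \<omega>))"
proof -
  \<comment> \<open>The four times may coincide while the process condition sums over a set of
    times. Coefficients built from Kronecker deltas add up correctly in every case.\<close>
  define d where "d y x = (if x = y then 1 else 0 :: real)" for x y :: real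
  define T where "T = {t, s, t', s'}"
  have delta: "(\<Sum>x\<in>T. d y x * X x \<omega>) = X y \<omega>" if "y \<in> T" for y \<omega>
    using that by (simp add: d_def T_def if_distrib[of "\<lambda>c. c * _"] sum.delta cong: if_cong)
  have "(\<lambda>\<omega>. \<Sum>x\<in>T. (a * (d t x - d s x) + b * (d t' x - d s' x)) * X x \<omega>)
    = (\<lambda>\<omega>. a * ((\<Sum>x\<in>T. d t x * X x \<omega>) - (\<Sum>x\<in>T. d s x * X x \<omega>))
        + b * ((\<Sum>x\<in>T. d t' x * X x \<omega>) - (\<Sum>x\<in>T. d s' x * X x \<omega>)))"
    by (simp add: sum_distrib_left sum.distrib sum_subtractf algebra_simps)
  also have "\<dots> = (\<lambda>\<omega>. a * (X t \<omega> - X s \<omega>) + b * (X t' \<omega> - X s' \<omega>))"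
    by (subst (1 2 3 4) delta) (auto simp: T_def)
  finally show ?thesis
    using gaussian unfolding centered_gaussian_process_def
    by (elim allE[of _ T] allE[of _ "\<lambda>x. a * (d t x - d s x) + b * (d t' x - d s' x)"]) (simp add: T_def)
qed

lemma increment_gaussian: "centered_gaussian M (\<lambda>\<omega>. X t \<omega> - X s \<omega>)"
  using increments_jointly_gaussian[of 1 t s 0] by simp

lemma increment_second_moment: "expectation (\<lambda>\<omega>. (X t \<omega> - X s \<omega>)\<^sup>2) = v (t - s)"
proof -
  \<comment> \<open>The increment from s to t is the coordinate t - s of the path re-based at s, so
    equality of path laws projects to it.\<close>
  have law: "distr M borel (\<lambda>\<omega>. X (t - s + h) \<omega> - X h \<omega>)
      = distr (distr M (\<Pi>\<^sub>M t\<in>UNIV. borel) (\<lambda>\<omega> t. X (t + h) \<omega> - X h \<omega>)) borel (\<lambda>x. x (t - s))" for h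
    by (subst distr_distr) (auto simp: o_def intro!: measurable_PiM_single' borel_measurable_diff)
  have "distr (distr M (\<Pi>\<^sub>M t\<in>UNIV. borel) (\<lambda>\<omega> t. X (t + s) \<omega> - X s \<omega>)) borel (\<lambda>x. x (t - s))
      = distr (distr M (\<Pi>\<^sub>M t\<in>UNIV. borel) (\<lambda>\<omega> t. X (t + 0) \<omega> - X 0 \<omega>)) borel (\<lambda>x. x (t - s))"
    using stationary by (simp add: stationary_increments_def)
  then have D: "distr M borel (\<lambda>\<omega>. X t \<omega> - X s \<omega>) = distr M borel (\<lambda>\<omega>. X (t - s) \<omega> - X 0 \<omega>)"
    unfolding law[symmetric] by simp
  have "expectation (\<lambda>\<omega>. (X t \<omega> - X s \<omega>)\<^sup>2) = (LINT x|distr M borel (\<lambda>\<omega>. X t \<omega> - X s \<omega>). x\<^sup>2)"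
    by (simp add: integral_distr)
  also have "\<dots> = expectation (\<lambda>\<omega>. (X (t - s) \<omega> - X 0 \<omega>)\<^sup>2)"
    unfolding D by (simp add: integral_distr)
  also have "\<dots> = expectation (\<lambda>\<omega>. (X (t - s) \<omega>)\<^sup>2)"
    using zero by (intro integral_cong_AE) auto
  finally show ?thesis
    by (simp add: variance_function_def centered_gaussian_moments(4)[OF X_gaussian])
qed

lemma increment_variance: "variance (\<lambda>\<omega>. X t \<omega> - X s \<omega>) = v (t - s)"
  using increment_second_moment centered_gaussian_moments(4)[OF increment_gaussian] by simp

text \<open>From 2 (b - a) (d - c) = (d - a)^2 + (c - b)^2 - (d - b)^2 - (c - a)^2. For disjoint
  intervals the right side is a second difference of \<open>v\<close>.\<close>

lemma increment_covariance:
  "expectation (\<lambda>\<omega>. (X t \<omega> - X s \<omega>) * (X t' \<omega> - X s' \<omega>))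
    = (v (t' - s) + v (s' - t) - v (t' - t) - v (s' - s)) / 2"
proof -
  note int = centered_gaussian_moments(2)[OF increment_gaussian]
  have "expectation (\<lambda>\<omega>. (X t \<omega> - X s \<omega>) * (X t' \<omega> - X s' \<omega>))
    = expectation (\<lambda>\<omega>. ((X t' \<omega> - X s \<omega>)\<^sup>2 + (X s' \<omega> - X t \<omega>)\<^sup>2 - (X t' \<omega> - X t \<omega>)\<^sup>2 - (X s' \<omega> - X s \<omega>)\<^sup>2) / 2)"
    by (intro Bochner_Integration.integral_cong) (auto simp: power2_eq_square algebra_simps)
  also have "\<dots> = (v (t' - s) + v (s' - t) - v (t' - t) - v (s' - s)) / 2"
    by (simp add: int increment_second_moment)
  finally show ?thesis .
qed

text \<open>Outside this event a continuous path moves by at most \<open>x\<close> on the unit interval starting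
  at \<open>k\<close>, provided the weights \<open>a\<close> sum to 1.\<close>

definition osc_event :: "(nat \<Rightarrow> real) \<Rightarrow> real \<Rightarrow> real \<Rightarrow> 'w set" where
  "osc_event a k x = {\<omega> \<in> space M. \<exists>m j. j < (2::nat) ^ m \<and>
     x * a m \<le> \<bar>X (k + real (Suc j) / 2 ^ m) \<omega> - X (k + real j / 2 ^ m) \<omega>\<bar>}"

lemma osc_event_measurable[measurable]: "osc_event a k x \<in> events"
  unfolding osc_event_def by measurable

lemma osc_event_complement:
  assumes "\<omega> \<in> space M - osc_event a k x" "continuous_on UNIV (\<lambda>t. X t \<omega>)"
    "a sums 1" "\<And>m. 0 \<le> a m" "x \<ge> 0" "0 \<le> r" "r \<le> 1"
  shows "\<bar>X (k + r) \<omega> - X k \<omega>\<bar> \<le> x"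
  using dyadic_chaining[of "\<lambda>t. X t \<omega>" a k x r] assms
  by (auto simp: sums_iff osc_event_def not_le intro: less_imp_le)

text \<open>A cell of level m has variance of order \<rho> ^ (4 m), while the weight
  \<open>a m\<close> is of order \<rho> ^ m. The exponent \<open>(a m)\<^sup>2\<close> over the
  variance therefore grows geometrically, like R ^ m, and beats the 2 ^ m cells of the level. The
  bound is uniform in k by stationarity.\<close>

lemma osc_event_prob:
  assumes AII: "assumption_AII v A \<alpha>"
  obtains a C \<kappa> where "a sums 1" "\<And>m. 0 \<le> a m" "C > 0" "\<kappa> > 0"
    "\<And>k x. x \<ge> 1 \<Longrightarrow> prob (osc_event a k x) \<le> C * exp (- \<kappa> * x\<^sup>2)"
proof -
  have \<alpha>: "\<alpha> > 0" using AII by (simp add: assumption_AII_def)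
  obtain V where V: "V > 0" "\<And>m::nat. v (1 / 2 ^ m) \<le> V * (1 / 2 ^ m) powr (2 * \<alpha>)"
    using AII_dyadic_bound[OF AII] by blast
  \<comment> \<open>Here \<alpha> is the exponent at 0. The weights decay with half the geometric
    rate of the standard deviations 2 powr (- \<alpha> m) = \<rho> ^ (2 m), hence stay
    summable.\<close>
  define \<rho> where "\<rho> = 2 powr (- \<alpha> / 2)"
  have \<rho>: "0 < \<rho>" "\<rho> < 1" using \<alpha> by (auto simp: \<rho>_def powr_less_one)
  define a where "a m = (1 - \<rho>) * \<rho> ^ m" for m :: nat
  have a: "a m > 0" for m using \<rho> by (simp add: a_def)
  define d where "d = (1 - \<rho>)\<^sup>2 / (2 * V)"
  define R where "R = 1 / \<rho>\<^sup>2"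
  have d: "d > 0" using \<rho> V by (simp add: d_def)
  have R: "R > 1" using \<rho> by (simp add: R_def power_less_one_iff)
  have dyad: "(1 / 2 ^ m) powr (2 * \<alpha>) = \<rho> ^ (4 * m)" for m :: nat
  proof -
    have "(1 / 2 ^ m :: real) = 2 powr (- real m)" by (simp add: powr_minus_divide powr_realpow)
    then have "(1 / 2 ^ m :: real) powr (2 * \<alpha>) = \<rho> powr real (4 * m)"
      by (simp only: \<rho>_def powr_powr) (simp add: algebra_simps)
    then show ?thesis using \<rho>(1) by (simp only: powr_realpow)
  qed
  have expo: "d * R ^ m = (a m)\<^sup>2 / (2 * (V * \<rho> ^ (4 * m)))" for m
  proof -
    have "\<rho> ^ (4 * m) = (\<rho>\<^sup>2 ^ m) * (\<rho>\<^sup>2 ^ m)"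
      by (simp add: power_mult[symmetric] power_add[symmetric])
    moreover have "(a m)\<^sup>2 = (1 - \<rho>)\<^sup>2 * \<rho>\<^sup>2 ^ m"
      by (simp add: a_def power_mult_distrib power_mult[symmetric] mult.commute)
    ultimately show ?thesis using \<rho> V by (simp add: d_def R_def power_divide)
  qed
  define b where "b m = 2 * 2 ^ m * exp (- (d * R ^ m) / 2)" for m :: nat
  have b: "summable b"
  proof (rule summable_comparison_test_ev)
    \<comment> \<open>One factor 2 ^ m counts the cells; the other yields the comparison with (1/2)
      ^ m.\<close>
    have "(\<lambda>m::nat. 4 ^ m * (2 * exp (- (d * R ^ m) / 2))) \<longlonglongrightarrow> 0" using d R by real_asymp
    then have "eventually (\<lambda>m::nat. 4 ^ m * (2 * exp (- (d * R ^ m) / 2)) < 1) sequentially"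
      by (rule order_tendstoD) simp
    then show "eventually (\<lambda>m. norm (b m) \<le> (1/2) ^ m) sequentially"
    proof eventually_elim
      case (elim m)
      have "(4::real) ^ m = 2 ^ m * 2 ^ m" by (simp flip: power_mult_distrib)
      then have "b m * 2 ^ m \<le> 1" using elim by (simp add: b_def mult_ac)
      then show ?case by (simp add: b_def power_divide field_simps)
    qed
    show "summable (\<lambda>m. (1/2) ^ m :: real)" by simp
  qed
  have bound: "prob (osc_event a k x) \<le> suminf b * exp (- (d / 2) * x\<^sup>2)" if x: "x \<ge> 1" for k x
  proof -
    define E where "E m j = {\<omega> \<in> space M. x * a m \<le> \<bar>X (k + real (Suc j) / 2 ^ m) \<omega> - X (k + real j / 2 ^ m) \<omega>\<bar>}" for m j :: nat
    have [measurable]: "E m j \<in> events" for m j unfolding E_def by measurable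
    have E: "prob (E m j) \<le> 2 * exp (- x\<^sup>2 * (d * R ^ m))" for m j
    proof -
      have "k + real (Suc j) / 2 ^ m - (k + real j / 2 ^ m) = 1 / 2 ^ m" by (simp add: field_simps)
      then have "variance (\<lambda>\<omega>. X (k + real (Suc j) / 2 ^ m) \<omega> - X (k + real j / 2 ^ m) \<omega>) \<le> V * \<rho> ^ (4 * m)"
        using V(2)[of m] unfolding increment_variance dyad by simp
      then have "prob (E m j) \<le> 2 * exp (- (x * a m)\<^sup>2 / (2 * (V * \<rho> ^ (4 * m))))"
        unfolding E_def using V \<rho> x a by (intro centered_gaussian_abs_tail increment_gaussian) auto
      also have "- (x * a m)\<^sup>2 / (2 * (V * \<rho> ^ (4 * m))) = - x\<^sup>2 * (d * R ^ m)"
        unfolding expo by (simp add: power_mult_distrib)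
      finally show ?thesis .
    qed
    have level: "prob (\<Union>j<2 ^ m. E m j) \<le> b m * exp (- (d / 2) * x\<^sup>2)" for m
    proof -
      have "prob (\<Union>j<2 ^ m. E m j) \<le> (\<Sum>j<(2::nat) ^ m. prob (E m j))"
        by (rule measure_UNION_le) auto
      also have "\<dots> \<le> (\<Sum>j<(2::nat) ^ m. 2 * exp (- x\<^sup>2 * (d * R ^ m)))" by (intro sum_mono E)
      also have "\<dots> = 2 * 2 ^ m * exp (- x\<^sup>2 * (d * R ^ m))" by simp
      \<comment> \<open>As x^2 >= 1 and R ^ m >= 1, the product x^2 R ^ m is at least the average of
        x^2 and R ^ m. One half pays for the sum over levels, the other is the Gaussian tail in
        x.\<close>
      also have "\<dots> \<le> 2 * 2 ^ m * (exp (- (d * R ^ m) / 2) * exp (- (d / 2) * x\<^sup>2))"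
      proof -
        have x2: "x\<^sup>2 \<ge> 1" and Rm: "R ^ m \<ge> 1" using x R by simp_all
        have "d * R ^ m * 1 \<le> d * R ^ m * x\<^sup>2" using x2 d R by (intro mult_left_mono) auto
        moreover have "d * x\<^sup>2 * 1 \<le> d * x\<^sup>2 * R ^ m" using Rm d by (intro mult_left_mono) auto
        ultimately have "- x\<^sup>2 * (d * R ^ m) \<le> - (d * R ^ m) / 2 + - (d / 2) * x\<^sup>2"
          by (simp add: algebra_simps)
        then show ?thesis by (subst exp_add[symmetric]) simp
      qed
      finally show ?thesis by (simp add: b_def)
    qed
    have "osc_event a k x = (\<Union>m. \<Union>j<2 ^ m. E m j)"
      by (auto simp: osc_event_def E_def)
    also have "prob \<dots> \<le> exp (- (d / 2) * x\<^sup>2) * suminf b"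
      by (rule prob_countable_UN_le[OF _ _ b]) (use level in \<open>auto simp: mult.commute\<close>)
    also have "\<dots> = suminf b * exp (- (d / 2) * x\<^sup>2)" by simp
    finally show ?thesis .
  qed
  show ?thesis
  proof (rule that)
    have "(\<lambda>m. (1 - \<rho>) * \<rho> ^ m) sums ((1 - \<rho>) * (1 / (1 - \<rho>)))"
      using \<rho> by (intro sums_mult geometric_sums) auto
    then show "a sums 1" using \<rho> by (simp add: a_def[abs_def])
    show "suminf b > 0" using b by (intro suminf_pos) (auto simp: b_def)
    show "d / 2 > 0" using d by simp
    show "0 \<le> a m" for m using a[of m] by simp
    show "x \<ge> 1 \<Longrightarrow> prob (osc_event a k x) \<le> suminf b * exp (- (d / 2) * x\<^sup>2)" for k x by (rule bound)
  qed
qed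

end

section \<open>The upper bound\<close>

lemma summable_if_square_mult_tendsto_0:
  fixes f :: "nat \<Rightarrow> real"
  assumes "(\<lambda>n. (real n)\<^sup>2 * f n) \<longlonglongrightarrow> 0"
  shows "summable f"
proof (rule summable_comparison_test_ev)
  show "summable (\<lambda>n. 1 / (real n)\<^sup>2)" by (rule inverse_power_summable[of 2, simplified inverse_eq_divide]) simp
  have "eventually (\<lambda>n. norm ((real n)\<^sup>2 * f n) < 1) sequentially"
    using order_tendstoD(2)[OF tendsto_norm[OF assms], of 1] by simp
  then show "eventually (\<lambda>n. norm (f n) \<le> 1 / (real n)\<^sup>2) sequentially"
    using eventually_gt_at_top[of 0]
    by eventually_elim (simp add: abs_mult pos_le_divide_eq mult.commute)
qed

lemma summable_exp_square:
  fixes k C :: real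
  assumes "k > 0"
  shows "summable (\<lambda>n. C * exp (- k * (real n)\<^sup>2))"
proof (rule summable_if_square_mult_tendsto_0)
  show "(\<lambda>n. (real n)\<^sup>2 * (C * exp (- k * (real n)\<^sup>2))) \<longlonglongrightarrow> 0"
    using assms by real_asymp
qed

lemma ln_powr_at_top:
  fixes m b :: real
  assumes "m > 0" "b > 0"
  shows "filterlim (\<lambda>t. (m * ln t) powr b) at_top at_top"
  using assms by real_asymp

lemma eventually_ln_le_ln_powr:
  fixes k m b :: real
  assumes "k > 0" "m > 0" "b > 1"
  shows "eventually (\<lambda>n::nat. 2 * ln (real n) \<le> k * (m * ln (real n)) powr b) sequentially"
  using assms by real_asymp

locale storage_model = gaussian_stationary_increments +
  fixes c A \<alpha> A\<^sub>0 \<alpha>\<^sub>0 :: real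
  assumes continuous: "AE \<omega> in M. continuous_on UNIV (\<lambda>t. X t \<omega>)"
    and AI: "assumption_AI v A \<alpha>" and AII: "assumption_AII v A\<^sub>0 \<alpha>\<^sub>0" and c_pos: "c > 0"
begin

section \<open>The critical level\<close>

lemma parameters: "A > 0" "0 < \<alpha>" "\<alpha> < 1" and v_pos: "t > 0 \<Longrightarrow> v t > 0"
  using AI by (auto simp: assumption_AI_def)

definition K :: real where "K = 2 * A / (storage_const c \<alpha>)\<^sup>2"

text \<open>Chosen so that the minimal exponent \<open>(storage_const c \<alpha>)\<^sup>2 / (2 * A)
  * u powr (2 - 2 * \<alpha>)\<close> at u = \<open>level \<theta> t\<close> equals \<theta> ln t;
  the critical value is \<theta> = 1.\<close>

definition level :: "real \<Rightarrow> real \<Rightarrow> real" where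
  "level \<theta> t = (\<theta> * K * ln t) powr (1 / (2 * (1 - \<alpha>)))"

lemma K_pos: "K > 0"
  using parameters c_pos storage_const_pos[of c \<alpha>] by (simp add: K_def)

lemma level_powr:
  assumes "\<theta> > 0" "t \<ge> 1"
  shows "level \<theta> t powr (2 - 2 * \<alpha>) = \<theta> * K * ln t"
proof -
  have "1 / (2 * (1 - \<alpha>)) * (2 - 2 * \<alpha>) = 1" using parameters by (simp add: field_simps)
  then show ?thesis using assms K_pos by (simp add: level_def powr_powr)
qed

lemma level_at_top: "\<theta> > 0 \<Longrightarrow> filterlim (level \<theta>) at_top at_top"
proof -
  assume "\<theta> > 0"
  then have "\<theta> * K > 0" "1 / (2 * (1 - \<alpha>)) > 0" using K_pos parameters by auto
  then show ?thesis unfolding level_def by (rule ln_powr_at_top)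
qed

text \<open>The square of the level is a power of ln n with exponent 1 / (1 - \<alpha>) > 1. Hence
  oscillation tails exp (- k u^2) are at most n powr (- 2).\<close>

lemma level_square_ge:
  assumes "\<theta> > 0" "k > 0"
  shows "eventually (\<lambda>n::nat. 2 * ln (real n) \<le> k * (level \<theta> (real n))\<^sup>2) sequentially"
proof -
  have "\<theta> * K > 0" "1 / (1 - \<alpha>) > 1" using assms K_pos parameters by auto
  then have "eventually (\<lambda>n::nat. 2 * ln (real n) \<le> k * ((\<theta> * K) * ln (real n)) powr (1 / (1 - \<alpha>))) sequentially"
    by (rule eventually_ln_le_ln_powr[OF \<open>k > 0\<close>])
  moreover have "2 * (1 / (2 * (1 - \<alpha>))) = 1 / (1 - \<alpha>)" using parameters by (simp add: field_simps)
  ultimately show ?thesis by (simp only: level_def powr_squared)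
qed

text \<open>The budget u + c \<tau> is shared: 1 - \<delta> for the grid increment and \<delta>/2
  for the oscillation at each end. Replacing the true distance t - s by \<tau> costs at most the
  additive c, since t - s >= \<tau> - 1.\<close>

lemma storage_le_of_grid:
  fixes n :: nat
  assumes cont: "continuous_on UNIV (\<lambda>t. X t \<omega>)" and \<omega>: "\<omega> \<in> space M"
    and a: "a sums 1" "\<And>m. 0 \<le> a m" and u: "u \<ge> 0" and \<delta>: "0 < \<delta>" "\<delta> < 1"
    and grid: "\<And>\<tau>::nat. \<tau> \<ge> 1 \<Longrightarrow> X (real n) \<omega> - X (real n - real \<tau>) \<omega> \<le> (1 - \<delta>) * (u + c * real \<tau>)"
    and osc: "\<And>\<tau>::nat. \<omega> \<notin> osc_event a (real n - real \<tau>) (\<delta> / 2 * (u + c * real \<tau>))"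
    and t: "real n \<le> t" "t < real n + 1"
  shows "storage_process X c t \<omega> \<le> ereal (u + c)"
  unfolding storage_process_def
proof (rule SUP_least)
  fix s assume "s \<in> {..t}"
  then have s: "s \<le> t" by simp
  define \<tau> where "\<tau> = nat (int n - \<lfloor>s\<rfloor>)"
  have "\<lfloor>s\<rfloor> \<le> int n" using s t by linarith
  then have fl: "real_of_int \<lfloor>s\<rfloor> = real n - real \<tau>" by (simp add: \<tau>_def)
  define r where "r = s - (real n - real \<tau>)"
  have r: "0 \<le> r" "r \<le> 1" unfolding r_def fl[symmetric] by linarith+
  have osc': "\<bar>X (real n - real \<tau> + r) \<omega> - X (real n - real \<tau>) \<omega>\<bar> \<le> \<delta> / 2 * (u + c * real \<tau>)"
    if "0 \<le> r" "r \<le> 1" for \<tau> r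
    using osc[of \<tau>] \<omega> u \<delta> c_pos that by (intro osc_event_complement[OF _ cont a]) auto
  have "\<bar>X t \<omega> - X (real n) \<omega>\<bar> \<le> \<delta> / 2 * u"
    using osc'[of "t - real n" 0] t by simp
  then have "X t \<omega> \<le> X (real n) \<omega> + \<delta> / 2 * u" by linarith
  moreover have "X (real n - real \<tau>) \<omega> - \<delta> / 2 * (u + c * real \<tau>) \<le> X s \<omega>"
  proof -
    have eq: "real n - real \<tau> + r = s" by (simp add: r_def)
    show ?thesis using osc'[OF r, of \<tau>] unfolding eq by linarith
  qed
  \<comment> \<open>For \<tau> = 0 the grid increment vanishes; \<open>grid\<close> covers only
    positive lengths.\<close>
  moreover have "X (real n) \<omega> - X (real n - real \<tau>) \<omega> \<le> (1 - \<delta>) * (u + c * real \<tau>)"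
    using grid[of \<tau>] u \<delta> by (cases "\<tau> = 0") auto
  moreover have "\<delta> / 2 * u \<le> \<delta> / 2 * (u + c * real \<tau>)" using \<delta> c_pos by simp
  moreover have "\<delta> / 2 * (u + c * real \<tau>) + \<delta> / 2 * (u + c * real \<tau>) + (1 - \<delta>) * (u + c * real \<tau>) = u + c * real \<tau>"
    by (simp add: field_simps)
  moreover have "c * (real \<tau> - 1) \<le> c * (t - s)"
    using r t c_pos by (intro mult_left_mono) (auto simp: r_def)
  ultimately have "X t \<omega> - X s \<omega> - c * (t - s) \<le> u + c"
    by (simp add: algebra_simps)
  then show "ereal (X t \<omega> - X s \<omega> - c * (t - s)) \<le> ereal (u + c)" by simp
qed

lemma storage_eventually_le_level:
  assumes \<theta>: "\<theta> > 1"
  shows "AE \<omega> in M. \<exists>N::nat. \<forall>n\<ge>N. \<forall>t. real n \<le> t \<and> t < real n + 1 \<longrightarrow>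
    storage_process X c t \<omega> \<le> ereal (level \<theta> (real n) + c)"
proof -
  have \<theta>_pos: "\<theta> > 0" using \<theta> by simp
  \<comment> \<open>The power of n in the grid estimate will be q: two factors 1 - \<delta> come
    from squaring the share of the grid increment, a third from the share of the exponent given to
    u, and 1 + \<delta> from the variance comparison.\<close>
  have "eventually (\<lambda>x::real. (1 - x) ^ 3 * \<theta> / (1 + x) > 1) (at_right 0)"
    using \<theta> by real_asymp
  moreover have "eventually (\<lambda>x::real. x < 1) (at_right 0)" by real_asymp
  ultimately have "eventually (\<lambda>x::real. (1 - x) ^ 3 * \<theta> / (1 + x) > 1 \<and> x < 1 \<and> 0 < x) (at_right 0)"
    using eventually_at_right_less[of 0] by eventually_elim auto
  then obtain \<delta> where \<delta>: "(1 - \<delta>) ^ 3 * \<theta> / (1 + \<delta>) > 1" "\<delta> < 1" "0 < \<delta>"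
    using eventually_happens'[OF trivial_limit_at_right_real] by blast
  define q where "q = (1 - \<delta>) ^ 3 * \<theta> / (1 + \<delta>)"
  define m\<^sub>0 where "m\<^sub>0 = (storage_const c \<alpha>)\<^sup>2 / (A * (1 + \<delta>))"
  have m0: "m\<^sub>0 * K = 2 / (1 + \<delta>)" "m\<^sub>0 > 0"
    using parameters c_pos \<delta> storage_const_pos[of c \<alpha>] by (auto simp: m\<^sub>0_def K_def)
  define G where "G u \<tau> = (u + c * real \<tau>)\<^sup>2 / v (real \<tau>)" for u and \<tau> :: nat
  obtain U where U: "\<And>u \<tau>. u \<ge> U \<Longrightarrow> \<tau> \<ge> (1::nat) \<Longrightarrow> m\<^sub>0 * u powr (2 - 2 * \<alpha>) \<le> G u \<tau>"
    using AI_exponent_lower[OF AI c_pos \<delta>(3)] unfolding m\<^sub>0_def G_def by metis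
  obtain \<kappa> where \<kappa>: "\<kappa> > 0" "\<And>u \<tau>. u \<ge> 0 \<Longrightarrow> \<tau> \<ge> (1::nat) \<Longrightarrow> \<kappa> * real \<tau> powr (2 - 2 * \<alpha>) \<le> G u \<tau>"
    using AI_exponent_summable[OF AI c_pos] unfolding G_def by metis
  obtain a C \<kappa>' where a: "a sums 1" "\<And>m. 0 \<le> a m" and C: "C > 0" and \<kappa>': "\<kappa>' > 0"
    and osc: "\<And>k x. x \<ge> 1 \<Longrightarrow> prob (osc_event a k x) \<le> C * exp (- \<kappa>' * x\<^sup>2)"
    using osc_event_prob[OF AII] by blast
  define u where "u n = level \<theta> (real n)" for n :: nat
  \<comment> \<open>Grid lengths start at 1, hence \<open>Suc \<tau>\<close>. The oscillation events
    include \<tau> = 0, the unit interval from n that contains t.\<close>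
  define E where "E n \<tau> = {\<omega> \<in> space M. (1 - \<delta>) * (u n + c * real (Suc \<tau>)) \<le> X (real n) \<omega> - X (real n - real (Suc \<tau>)) \<omega>}" for n \<tau> :: nat
  define F where "F n \<tau> = osc_event a (real n - real \<tau>) (\<delta> / 2 * (u n + c * real \<tau>))" for n \<tau> :: nat
  have [measurable]: "E n \<tau> \<in> events" "F n \<tau> \<in> events" for n \<tau> unfolding E_def F_def by measurable
  define d where "d = (1 - \<delta>)\<^sup>2 * \<delta> * \<kappa> / 2"
  define d' where "d' = \<kappa>' * (\<delta> / 2)\<^sup>2"
  have d: "d > 0" "d' > 0" using \<delta> \<kappa> \<kappa>' by (auto simp: d_def d'_def)
  have E_le: "prob (E n \<tau>) \<le> real n powr (- q) * exp (- d * real (Suc \<tau>) powr (2 - 2 * \<alpha>))"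
    if n: "n \<ge> 1" "u n \<ge> U" "u n \<ge> 0" for n \<tau>
  proof -
    let ?T = "Suc \<tau>"
    have vT: "v (real ?T) > 0" by (rule v_pos) simp
    have "prob (E n \<tau>) \<le> exp (- ((1 - \<delta>) * (u n + c * real ?T))\<^sup>2 / (2 * v (real ?T)))"
      unfolding E_def using n \<delta> c_pos vT
      by (intro centered_gaussian_tail increment_gaussian)
        (auto simp: increment_variance intro!: mult_pos_pos add_nonneg_pos simp del: of_nat_Suc)
    also have "- ((1 - \<delta>) * (u n + c * real ?T))\<^sup>2 / (2 * v (real ?T)) = - ((1 - \<delta>)\<^sup>2 / 2 * G (u n) ?T)"
      by (simp add: G_def power_mult_distrib)
    also have "exp \<dots> \<le> exp (- (q * ln (real n)) + - d * real ?T powr (2 - 2 * \<alpha>))"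
    proof -
      \<comment> \<open>Convex splitting of the exponent: the share 1 - \<delta> gives the power of
        n, the share \<delta> gives decay in the grid length.\<close>
      have "(1 - \<delta>) * (m\<^sub>0 * u n powr (2 - 2 * \<alpha>)) + \<delta> * (\<kappa> * real ?T powr (2 - 2 * \<alpha>))
          \<le> (1 - \<delta>) * G (u n) ?T + \<delta> * G (u n) ?T"
        using U[of "u n" ?T] \<kappa>(2)[of "u n" ?T] n \<delta> by (intro add_mono mult_left_mono) auto
      also have "\<dots> = G (u n) ?T" by (simp add: algebra_simps)
      finally have "(1 - \<delta>)\<^sup>2 / 2 * ((1 - \<delta>) * (m\<^sub>0 * u n powr (2 - 2 * \<alpha>)) + \<delta> * (\<kappa> * real ?T powr (2 - 2 * \<alpha>)))
          \<le> (1 - \<delta>)\<^sup>2 / 2 * G (u n) ?T"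
        by (rule mult_left_mono) simp
      moreover have "(1 - \<delta>)\<^sup>2 / 2 * ((1 - \<delta>) * (m\<^sub>0 * u n powr (2 - 2 * \<alpha>))) = q * ln (real n)"
      proof -
        have "m\<^sub>0 * u n powr (2 - 2 * \<alpha>) = (m\<^sub>0 * K) * (\<theta> * ln (real n))"
          using level_powr[of \<theta> "real n"] n \<theta> by (simp add: u_def)
        then show ?thesis unfolding m0(1) by (simp add: q_def power2_eq_square power3_eq_cube)
      qed
      moreover have "(1 - \<delta>)\<^sup>2 / 2 * (\<delta> * (\<kappa> * real ?T powr (2 - 2 * \<alpha>))) = d * real ?T powr (2 - 2 * \<alpha>)"
        by (simp add: d_def)
      ultimately have "q * ln (real n) + d * real ?T powr (2 - 2 * \<alpha>) \<le> (1 - \<delta>)\<^sup>2 / 2 * G (u n) ?T"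
        by (simp only: distrib_left)
      then show ?thesis by simp
    qed
    also have "\<dots> = real n powr (- q) * exp (- d * real ?T powr (2 - 2 * \<alpha>))"
      using n unfolding exp_add by (simp add: powr_def)
    finally show ?thesis .
  qed
  have F_le: "prob (F n \<tau>) \<le> real n powr (- 2) * (C * exp (- (d' * c\<^sup>2) * (real \<tau>)\<^sup>2))"
    if n: "n \<ge> 1" "u n \<ge> 2 / \<delta>" "2 * ln (real n) \<le> d' * (u n)\<^sup>2" for n \<tau>
  proof -
    have "2 / \<delta> > 0" using \<delta> by simp
    with n have u0: "u n > 0" by linarith
    have "1 \<le> \<delta> / 2 * u n" using n \<delta> by (simp add: field_simps)
    also have "\<dots> \<le> \<delta> / 2 * (u n + c * real \<tau>)" using \<delta> c_pos by simp
    finally have "prob (F n \<tau>) \<le> C * exp (- \<kappa>' * (\<delta> / 2 * (u n + c * real \<tau>))\<^sup>2)"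
      unfolding F_def by (rule osc)
    also have "- \<kappa>' * (\<delta> / 2 * (u n + c * real \<tau>))\<^sup>2 = - (d' * (u n + c * real \<tau>)\<^sup>2)"
      unfolding power_mult_distrib[of "\<delta> / 2"] by (simp add: d'_def)
    also have "C * exp \<dots> \<le> C * exp (- (2 * ln (real n)) + - (d' * c\<^sup>2) * (real \<tau>)\<^sup>2)"
    proof -
      \<comment> \<open>The term in u gives n powr (- 2), the term in \<tau> makes the sum over grid
        lengths converge.\<close>
      have "d' * ((u n)\<^sup>2 + (c * real \<tau>)\<^sup>2) \<le> d' * (u n + c * real \<tau>)\<^sup>2"
        using d c_pos u0 by (intro mult_left_mono) (auto simp: power2_sum)
      with n(3) have "- (d' * (u n + c * real \<tau>)\<^sup>2) \<le> - (2 * ln (real n)) + - (d' * c\<^sup>2) * (real \<tau>)\<^sup>2"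
        by (simp add: power_mult_distrib distrib_left)
      then show ?thesis using C by simp
    qed
    also have "\<dots> = real n powr (- 2) * (C * exp (- (d' * c\<^sup>2) * (real \<tau>)\<^sup>2))"
      using n unfolding exp_add by (simp add: powr_def)
    finally show ?thesis .
  qed
  define S where "S = (\<Sum>\<tau>. exp (- d * real (Suc \<tau>) powr (2 - 2 * \<alpha>)))"
  define S' where "S' = (\<Sum>\<tau>. C * exp (- (d' * c\<^sup>2) * (real \<tau>)\<^sup>2))"
  have "2 - 2 * \<alpha> > 0" using parameters by simp
  then have "(\<lambda>\<tau>::nat. (real \<tau>)\<^sup>2 * exp (- d * real (Suc \<tau>) powr (2 - 2 * \<alpha>))) \<longlonglongrightarrow> 0"
    using d(1) by real_asymp
  note sum1 = summable_if_square_mult_tendsto_0[OF this]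
  have "d' * c\<^sup>2 > 0" using d c_pos by simp
  note sum2 = summable_exp_square[OF this, of C]
  define bad where "bad n = (\<Union>\<tau>. E n \<tau>) \<union> (\<Union>\<tau>. F n \<tau>)" for n
  have [measurable]: "bad n \<in> events" for n unfolding bad_def by measurable
  have u_lim: "filterlim u at_top sequentially"
    unfolding u_def using \<theta> by (intro filterlim_compose[OF level_at_top filterlim_real_sequentially]) auto
  have "eventually (\<lambda>n. norm (prob (bad n)) \<le> real n powr (- q) * S + real n powr (- 2) * S') sequentially"
    using eventually_ge_at_top[of 1] filterlim_at_top[THEN iffD1, OF u_lim, rule_format, of "max U (2 / \<delta>)"]
      level_square_ge[OF \<theta>_pos d(2), folded u_def]
  proof eventually_elim
    case (elim n)
    then have u: "u n \<ge> U" "u n \<ge> 2 / \<delta>" "2 * ln (real n) \<le> d' * (u n)\<^sup>2" by auto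
    have "2 / \<delta> > 0" using \<delta> by simp
    with u have u0: "u n \<ge> 0" by linarith
    have "prob (bad n) \<le> prob (\<Union>\<tau>. E n \<tau>) + prob (\<Union>\<tau>. F n \<tau>)"
      unfolding bad_def by (rule measure_Un_le) measurable
    also have "prob (\<Union>\<tau>. E n \<tau>) \<le> real n powr (- q) * S"
      unfolding S_def using elim u u0 by (intro prob_countable_UN_le sum1 E_le) auto
    also have "prob (\<Union>\<tau>. F n \<tau>) \<le> real n powr (- 2) * S'"
      unfolding S'_def using elim u u0 by (intro prob_countable_UN_le sum2 F_le) auto
    finally show ?case by simp
  qed
  moreover have "summable (\<lambda>n. real n powr (- q) * S + real n powr (- 2) * S')"
    using \<delta>(1) by (intro summable_add summable_mult2) (auto simp: summable_real_powr_iff q_def)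
  ultimately have "summable (\<lambda>n. prob (bad n))"
    by (rule summable_comparison_test_ev)
  then have "AE \<omega> in M. eventually (\<lambda>n. \<omega> \<in> space M - bad n) sequentially"
    by (intro borel_cantelli_AE1) (auto simp: less_top[symmetric])
  then show ?thesis
    using continuous
  proof eventually_elim
    case (elim \<omega>)
    then have "eventually (\<lambda>n. \<omega> \<in> space M - bad n \<and> u n \<ge> 0) sequentially"
      by (intro eventually_conj filterlim_at_top[THEN iffD1, OF u_lim, rule_format])
    then obtain N where N: "\<And>n. n \<ge> N \<Longrightarrow> \<omega> \<in> space M - bad n \<and> u n \<ge> 0"
      by (auto simp: eventually_sequentially)
    show ?case
    proof (intro exI[of _ N] allI impI)
      fix n t assume n: "N \<le> n" and t: "real n \<le> t \<and> t < real n + 1"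
      show "storage_process X c t \<omega> \<le> ereal (level \<theta> (real n) + c)"
        unfolding u_def[symmetric]
      proof (rule storage_le_of_grid[OF elim(2) _ a _ \<delta>(3,2)])
        fix \<tau> :: nat assume "\<tau> \<ge> 1"
        then obtain \<tau>' where "\<tau> = Suc \<tau>'" by (cases \<tau>) auto
        then show "X (real n) \<omega> - X (real n - real \<tau>) \<omega> \<le> (1 - \<delta>) * (u n + c * real \<tau>)"
          using N[OF n] by (auto simp: bad_def E_def not_le intro: less_imp_le)
      qed (use N[OF n] t in \<open>auto simp: bad_def F_def\<close>)
    qed
  qed
qed

end

section \<open>The lower bound\<close>

text \<open>Since i <= j - 1, the smaller power is at most (j - 1) * j powr \<delta>.\<close>

lemma powr_gap:
  fixes i j :: nat
  assumes "i < j" "\<delta> > 0"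
  shows "real j powr \<delta> \<le> real j powr (1 + \<delta>) - real i powr (1 + \<delta>)"
proof -
  have "real i powr (1 + \<delta>) = real i * real i powr \<delta>"
    by (cases "i = 0") (auto simp: powr_add)
  also have "\<dots> \<le> (real j - 1) * real j powr \<delta>"
    using assms by (intro mult_mono powr_mono2) auto
  also have "\<dots> = real j powr (1 + \<delta>) - real j powr \<delta>"
    using assms by (simp add: powr_add algebra_simps)
  finally show ?thesis by simp
qed

text \<open>With w = sqrt (2 q ln n) the exponent (w + 1)^2 / 2 is q ln n + w + 1/2. As q < 1 and w
  is of order sqrt (ln n), this stays below ln n even with the normalizing constant, collected in
  L.\<close>

lemma inverse_nat_le_normal_density:
  fixes q :: real
  assumes "0 < q" "q < 1"
  shows "eventually (\<lambda>n. 1 / real n \<le> normal_density 0 1 (sqrt (2 * q * ln (real n)) + 1)) sequentially"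
proof -
  define L where "L = 1 / 2 + ln (sqrt (2 * pi))"
  have ln_lim: "filterlim (\<lambda>n::nat. ln (real n)) at_top sequentially" by real_asymp
  have "eventually (\<lambda>x::real. q * x + sqrt (2 * q * x) + L \<le> x) at_top"
    using assms by real_asymp
  then have "eventually (\<lambda>n::nat. q * ln (real n) + sqrt (2 * q * ln (real n)) + L \<le> ln (real n)) sequentially"
    by (rule eventually_compose_filterlim[OF _ ln_lim])
  then show ?thesis
    using eventually_ge_at_top[of 1]
  proof eventually_elim
    case (elim n)
    define w where "w = sqrt (2 * q * ln (real n))"
    have w2: "w\<^sup>2 = 2 * q * ln (real n)" using assms elim by (simp add: w_def)
    have "1 / real n = exp (- ln (real n))" using elim by (simp add: exp_minus inverse_eq_divide)
    also have "\<dots> \<le> exp (- (w + 1)\<^sup>2 / 2 - ln (sqrt (2 * pi)))"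
    proof -
      have "- (w + 1)\<^sup>2 / 2 = - (q * ln (real n)) - w - 1 / 2"
        unfolding power2_sum w2 by (simp add: field_simps)
      then show ?thesis using elim by (simp add: L_def w_def)
    qed
    also have "\<dots> = exp (- (w + 1)\<^sup>2 / 2) / exp (ln (sqrt (2 * pi)))" by (rule exp_diff)
    also have "\<dots> = normal_density 0 1 (w + 1)"
      by (simp add: normal_density_def)
    finally show ?case by (simp add: w_def)
  qed
qed

text \<open>On a window of length 1 to the right of 0 the density is smallest at the right
  end.\<close>

lemma (in prob_space) normal_unit_interval_prob_ge:
  assumes Y: "centered_gaussian M Y" "variance Y = 1" and w: "w \<ge> 0"
  shows "normal_density 0 1 (w + 1) \<le> prob {\<omega> \<in> space M. Y \<omega> \<in> {w<..w + 1}}"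
proof -
  have D: "distributed M lborel Y (\<lambda>x. ennreal (normal_density 0 1 x))"
    using centered_gaussian_variance_pos[OF Y(1)] Y(2) by simp
  have "ennreal (normal_density 0 1 (w + 1)) = (\<integral>\<^sup>+y. ennreal (normal_density 0 1 (w + 1)) * indicator {w<..w + 1} y \<partial>lborel)"
    by (subst nn_integral_cmult_indicator) auto
  also have "\<dots> \<le> (\<integral>\<^sup>+y. ennreal (normal_density 0 1 y) * indicator {w<..w + 1} y \<partial>lborel)"
  proof (rule nn_integral_mono)
    fix y
    have "y\<^sup>2 \<le> (w + 1)\<^sup>2" if "y \<in> {w<..w + 1}" using that w by (intro power_mono) auto
    then show "ennreal (normal_density 0 1 (w + 1)) * indicator {w<..w + 1} y
        \<le> ennreal (normal_density 0 1 y) * indicator {w<..w + 1} y"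
      by (auto split: split_indicator simp: normal_density_def intro!: ennreal_leI divide_right_mono)
  qed
  also have "\<dots> = emeasure M (Y -` {w<..w + 1} \<inter> space M)"
    by (rule distributed_emeasure[OF D, symmetric]) simp
  also have "Y -` {w<..w + 1} \<inter> space M = {\<omega> \<in> space M. Y \<omega> \<in> {w<..w + 1}}" by auto
  finally show ?thesis by (simp add: emeasure_eq_measure)
qed

text \<open>Powers of ln n against powers of n. \<open>\<rho>\<close> will bound the correlations;
  it must stay small even after multiplication by the squared window height that enters the density
  ratio.\<close>

lemma correlation_bound_tendsto_0:
  fixes C k m b d g q :: real
  assumes "C > 0" "k > 0" "m > 0" "b > 0" "d > 0" "g > 0" "q > 0"
  defines "\<rho> \<equiv> \<lambda>n::nat. C * (k * (m * ln (real n)) powr b)\<^sup>2 * (real n powr d / 2) powr (- g)"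
  shows "\<rho> \<longlonglongrightarrow> 0" "(\<lambda>n. \<rho> n * (sqrt (2 * q * ln (real n)) + 1)\<^sup>2) \<longlonglongrightarrow> 0"
    "eventually (\<lambda>n. k * (m * ln (real n)) powr b \<le> real n powr d / 2) sequentially"
  unfolding \<rho>_def using assms(1-7) by real_asymp+

context storage_model
begin

lemma storage_frequently_ge_level:
  assumes \<theta>: "0 < \<theta>" "\<theta> < 1"
  shows "AE \<omega> in M. \<exists>\<^sub>F t in at_top. ereal (level \<theta> t) \<le> storage_process X c t \<omega>"
proof -
  \<comment> \<open>One factor 1 + \<delta> comes from ln (t n) = (1 + \<delta>) ln n, the other
    from the upper bound on the exponent at the optimal length.\<close>
  have "eventually (\<lambda>x::real. \<theta> * (1 + x) ^ 2 < 1) (at_right 0)" using \<theta> by real_asymp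
  then have "eventually (\<lambda>x::real. \<theta> * (1 + x) ^ 2 < 1 \<and> 0 < x) (at_right 0)"
    using eventually_at_right_less[of 0] by eventually_elim auto
  then obtain \<delta> where \<delta>: "\<theta> * (1 + \<delta>) ^ 2 < 1" "0 < \<delta>"
    using eventually_happens'[OF trivial_limit_at_right_real] by blast
  define q where "q = \<theta> * (1 + \<delta>) ^ 2"
  have q: "0 < q" "q < 1" using \<theta> \<delta> by (auto simp: q_def)
  define k where "k = \<alpha> / (c * (1 - \<alpha>))"
  have k: "k > 0" using parameters c_pos by (simp add: k_def)
  define t where "t n = real n powr (1 + \<delta>)" for n :: nat
  define u where "u n = level \<theta> (t n)" for n
  define \<tau> where "\<tau> n = k * u n" for n
  define w where "w n = sqrt (2 * q * ln (real n))" for n :: nat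
  define Y where "Y n \<omega> = 1 / sqrt (v (\<tau> n)) * (X (t n) \<omega> - X (t n - \<tau> n) \<omega>)" for n \<omega>
  define B where "B n = {\<omega> \<in> space M. Y n \<omega> \<in> {w n<..w n + 1}}" for n
  have Y_meas[measurable]: "Y n \<in> borel_measurable M" for n unfolding Y_def by measurable
  have B_meas[measurable]: "B n \<in> events" for n unfolding B_def by measurable
  have t_lim: "filterlim t at_top sequentially" unfolding t_def using \<delta> by real_asymp
  have u_lim: "filterlim u at_top sequentially"
    unfolding u_def by (rule filterlim_compose[OF level_at_top[OF \<theta>(1)] t_lim])
  have \<tau>_lim: "filterlim \<tau> at_top sequentially"
    unfolding \<tau>_def by (rule filterlim_tendsto_pos_mult_at_top[OF tendsto_const k u_lim])
  define m b where "m = \<theta> * K * (1 + \<delta>)" and "b = 1 / (2 * (1 - \<alpha>))"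
  have mb: "m > 0" "b > 0" using \<theta> \<delta> K_pos parameters by (auto simp: m_def b_def)
  have u_eq: "u n = (m * ln (real n)) powr b" if "n \<ge> 1" for n
    using that by (simp add: u_def level_def t_def m_def b_def ln_powr mult.assoc)
  have \<tau>_mono: "\<tau> i \<le> \<tau> j" if "1 \<le> i" "i \<le> j" for i j
    using that k mb unfolding \<tau>_def by (simp add: u_eq powr_mono2 mult_left_mono)
  have w_mono: "w i \<le> w j" if "1 \<le> i" "i \<le> j" for i j
    using that q by (simp add: w_def)
  have w_nonneg: "w n \<ge> 0" if "1 \<le> n" for n
    using that q by (simp add: w_def)

  have lim: "((\<lambda>t. v t / t powr (2 * \<alpha>)) \<longlongrightarrow> A) at_top" using AI by (simp add: assumption_AI_def)
  have "filterlim (\<lambda>t. v t / t powr (2 * \<alpha>) * t powr (2 * \<alpha>)) at_top at_top"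
    using parameters by (intro filterlim_tendsto_pos_mult_at_top[OF lim]) (auto, real_asymp)
  then have "eventually (\<lambda>t. v t / t powr (2 * \<alpha>) * t powr (2 * \<alpha>) \<ge> 1) at_top"
    by (simp add: filterlim_at_top)
  then have "eventually (\<lambda>t. v t \<ge> 1) at_top"
    using eventually_gt_at_top[of 0] by eventually_elim simp
  \<comment> \<open>Variances at least 1 let the normalizing factors be dropped from the correlation
    bound; the loss is harmless against the power decay.\<close>
  then have v_ge: "eventually (\<lambda>n. v (\<tau> n) \<ge> 1) sequentially"
    by (rule eventually_compose_filterlim[OF _ \<tau>_lim])

  have Y_gauss: "centered_gaussian M (\<lambda>\<omega>. a * Y i \<omega> + a' * Y j \<omega>)" for a a' i j
    using increments_jointly_gaussian[of "a / sqrt (v (\<tau> i))" "t i" "t i - \<tau> i" "a' / sqrt (v (\<tau> j))" "t j" "t j - \<tau> j"]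
    by (simp add: Y_def)
  have Y_var: "variance (Y n) = 1" if "v (\<tau> n) \<ge> 1" for n
  proof -
    have "variance (Y n) = expectation (\<lambda>\<omega>. (Y n \<omega>)\<^sup>2)"
      using centered_gaussian_moments(4)[of "Y n"] Y_gauss[of 1 n 0] by simp
    also have "\<dots> = expectation (\<lambda>\<omega>. (1 / sqrt (v (\<tau> n)))\<^sup>2 * (X (t n) \<omega> - X (t n - \<tau> n) \<omega>)\<^sup>2)"
      by (simp only: Y_def power_mult_distrib)
    also have "\<dots> = (1 / sqrt (v (\<tau> n)))\<^sup>2 * v (\<tau> n)"
      by (subst integral_mult_right_zero) (simp add: increment_second_moment)
    finally show ?thesis using that by (simp add: power_divide)
  qed
  have Y_cov: "expectation (\<lambda>\<omega>. Y i \<omega> * Y j \<omega>) = 1 / sqrt (v (\<tau> i)) * (1 / sqrt (v (\<tau> j))) *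
      ((v (t j - (t i - \<tau> i)) + v (t j - \<tau> j - t i) - v (t j - t i) - v (t j - \<tau> j - (t i - \<tau> i))) / 2)" for i j
  proof -
    have "expectation (\<lambda>\<omega>. Y i \<omega> * Y j \<omega>) = expectation (\<lambda>\<omega>. (1 / sqrt (v (\<tau> i)) * (1 / sqrt (v (\<tau> j)))) *
      ((X (t i) \<omega> - X (t i - \<tau> i) \<omega>) * (X (t j) \<omega> - X (t j - \<tau> j) \<omega>)))"
      by (simp add: Y_def mult_ac)
    then show ?thesis by (simp only: integral_mult_right_zero increment_covariance)
  qed

  obtain C T where CT: "C > 0" "T > 0"
    "\<And>a h k. a \<ge> T \<Longrightarrow> h > 0 \<Longrightarrow> k > 0 \<Longrightarrow>
       \<bar>v (a + h + k) - v (a + h) - v (a + k) + v a\<bar> \<le> C * h * k * a powr (2 * \<alpha> - 2)"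
    using AI_second_difference[OF AI] by metis
  define \<rho> where "\<rho> n = C * (k * (m * ln (real n)) powr b)\<^sup>2 * (real n powr \<delta> / 2) powr (- (2 - 2 * \<alpha>))" for n :: nat
  have "2 - 2 * \<alpha> > 0" using parameters by simp
  note asymp = correlation_bound_tendsto_0[OF CT(1) k mb \<delta>(2) this q(1), folded \<rho>_def w_def]
  define good where "good n \<longleftrightarrow> n \<ge> 1 \<and> v (\<tau> n) \<ge> 1 \<and> \<tau> n > 0 \<and> \<tau> n \<le> real n powr \<delta> / 2 \<and> real n powr \<delta> / 2 \<ge> T \<and> \<rho> n < 1" for n
  have good: "eventually good sequentially"
  proof -
    have "eventually (\<lambda>n. \<tau> n \<le> real n powr \<delta> / 2) sequentially"
      using asymp(3) eventually_ge_at_top[of 1] by eventually_elim (simp add: \<tau>_def u_eq)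
    moreover have "eventually (\<lambda>n. T \<le> real n powr \<delta> / 2) sequentially"
      using \<delta> by real_asymp
    moreover have "eventually (\<lambda>n. \<tau> n > 0) sequentially"
      using \<tau>_lim by (simp add: filterlim_at_top_dense)
    moreover have "eventually (\<lambda>n. \<rho> n < 1) sequentially"
      using order_tendstoD(2)[OF asymp(1), of 1] by simp
    ultimately show ?thesis
      using v_ge eventually_ge_at_top[of 1] unfolding good_def by eventually_elim auto
  qed
  have corr: "\<bar>expectation (\<lambda>\<omega>. Y i \<omega> * Y j \<omega>)\<bar> \<le> \<rho> j" if ij: "i < j" "good i" "good j" for i j
  proof -
    \<comment> \<open>The distance between the two disjoint increment intervals; the covariance is
      half the second difference of \<open>v\<close> based at it, with steps \<open>\<tau> i\<close>
      and \<open>\<tau> j\<close>.\<close>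
    define a where "a = t j - \<tau> j - t i"
    have pos: "\<tau> i > 0" "\<tau> j > 0" "v (\<tau> i) \<ge> 1" "v (\<tau> j) \<ge> 1" using ij by (auto simp: good_def)
    \<comment> \<open>The times differ by at least j powr \<delta>, of which the length
      \<open>\<tau> j\<close> uses at most half.\<close>
    have gap: "real j powr \<delta> / 2 \<le> a"
      using powr_gap[OF ij(1) \<delta>(2)] ij(3) by (simp add: a_def t_def good_def)
    with ij have aT: "a \<ge> T" by (simp add: good_def)
    have "1 / sqrt (v (\<tau> i)) * (1 / sqrt (v (\<tau> j))) \<le> 1 * 1"
      using pos by (intro mult_mono) auto
    moreover have "1 / sqrt (v (\<tau> i)) * (1 / sqrt (v (\<tau> j))) \<ge> 0" using pos by simp
    ultimately have s: "\<bar>1 / sqrt (v (\<tau> i)) * (1 / sqrt (v (\<tau> j)))\<bar> \<le> 1" by simp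
    have d: "t j - (t i - \<tau> i) = a + \<tau> i + \<tau> j" "t j - \<tau> j - t i = a" "t j - t i = a + \<tau> j"
      "t j - \<tau> j - (t i - \<tau> i) = a + \<tau> i" by (auto simp: a_def)
    have "\<bar>expectation (\<lambda>\<omega>. Y i \<omega> * Y j \<omega>)\<bar>
        = \<bar>1 / sqrt (v (\<tau> i)) * (1 / sqrt (v (\<tau> j)))\<bar> * (\<bar>v (a + \<tau> i + \<tau> j) - v (a + \<tau> i) - v (a + \<tau> j) + v a\<bar> / 2)"
      unfolding Y_cov d abs_mult abs_divide by (simp add: algebra_simps)
    also have "\<dots> \<le> 1 * \<bar>v (a + \<tau> i + \<tau> j) - v (a + \<tau> i) - v (a + \<tau> j) + v a\<bar>"
      using s by (intro mult_mono) auto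
    also have "\<dots> \<le> C * \<tau> i * \<tau> j * a powr (2 * \<alpha> - 2)"
      using CT(3)[OF aT pos(1,2)] by simp
    also have "\<dots> \<le> C * \<tau> j * \<tau> j * (real j powr \<delta> / 2) powr (2 * \<alpha> - 2)"
      using CT(1) pos \<tau>_mono[of i j] ij gap parameters
      by (intro mult_mono powr_mono2') (auto simp: good_def)
    also have "\<dots> = \<rho> j"
      using ij by (simp add: \<rho>_def \<tau>_def u_eq good_def power2_eq_square)
    finally show ?thesis .
  qed
  have pair: "prob (B i \<inter> B j) \<le> exp (\<rho> j * (w j + 1)\<^sup>2 / (1 - (\<rho> j)\<^sup>2)) / sqrt (1 - (\<rho> j)\<^sup>2) * (prob (B i) * prob (B j))"
    if ij: "i < j" "good i" "good j" for i j
  proof -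
    define r where "r = expectation (\<lambda>\<omega>. Y i \<omega> * Y j \<omega>)"
    have r: "\<bar>r\<bar> \<le> \<rho> j" "\<rho> j < 1" using corr[OF ij] ij by (auto simp: r_def good_def)
    have wij: "0 \<le> w i" "w i \<le> w j" using w_nonneg[of i] w_mono[of i j] ij by (auto simp: good_def)
    have "B i \<inter> B j = {\<omega> \<in> space M. Y i \<omega> \<in> {w i<..w i + 1} \<and> Y j \<omega> \<in> {w j<..w j + 1}}"
      by (auto simp: B_def)
    \<comment> \<open>Both windows lie below w j + 1 because w is increasing, so this serves as P
      and as Q.\<close>
    also have "prob \<dots> \<le> exp (\<bar>r\<bar> * (w j + 1) * (w j + 1) / (1 - r\<^sup>2)) / sqrt (1 - r\<^sup>2) * (prob (B i) * prob (B j))"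
      unfolding B_def using r wij ij
      by (intro gaussian_pair_bounded_sets_prob_le Y_gauss Y_var r_def[symmetric]) (auto simp: good_def)
    also have "exp (\<bar>r\<bar> * (w j + 1) * (w j + 1) / (1 - r\<^sup>2)) / sqrt (1 - r\<^sup>2)
        \<le> exp (\<rho> j * (w j + 1)\<^sup>2 / (1 - (\<rho> j)\<^sup>2)) / sqrt (1 - (\<rho> j)\<^sup>2)"
    proof -
      have r2: "r\<^sup>2 \<le> (\<rho> j)\<^sup>2" using r(1) by (subst abs_le_square_iff[symmetric]) auto
      have "(\<rho> j)\<^sup>2 < 1" using r by (simp add: abs_square_less_1)
      then show ?thesis
        using r r2 by (intro frac_le) (auto simp: power2_eq_square mult.assoc intro!: frac_le mult_right_mono)
    qed
    finally show ?thesis by (simp add: mult_right_mono)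
  qed
  have factor: "(\<lambda>n. exp (\<rho> n * (w n + 1)\<^sup>2 / (1 - (\<rho> n)\<^sup>2)) / sqrt (1 - (\<rho> n)\<^sup>2)) \<longlonglongrightarrow> 1"
  proof -
    have "(\<lambda>n. exp (\<rho> n * (w n + 1)\<^sup>2 / (1 - (\<rho> n)\<^sup>2)) / sqrt (1 - (\<rho> n)\<^sup>2)) \<longlonglongrightarrow> exp (0 / (1 - 0\<^sup>2)) / sqrt (1 - 0\<^sup>2)"
      by (intro tendsto_intros asymp) auto
    then show ?thesis by simp
  qed

  have io: "AE \<omega> in M. \<exists>\<^sub>\<infinity>n. \<omega> \<in> B n"
  proof (rule borel_cantelli_second_moment[OF B_meas])
    show "\<not> summable (\<lambda>n. prob (B n))"
    proof
      assume summ: "summable (\<lambda>n. prob (B n))"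
      have "eventually (\<lambda>n. norm (1 / real n) \<le> prob (B n)) sequentially"
        using inverse_nat_le_normal_density[OF q] good
      proof eventually_elim
        case (elim n)
        then have "normal_density 0 1 (w n + 1) \<le> prob (B n)"
          unfolding B_def using Y_gauss[of 1 n 0] w_nonneg
          by (intro normal_unit_interval_prob_ge Y_var) (auto simp: good_def)
        then show ?case using elim by (simp add: w_def)
      qed
      then have "summable (\<lambda>n. 1 / real n)" by (rule summable_comparison_test_ev[OF _ summ])
      then have "summable (\<lambda>n. real n powr (- 1))" by (simp add: powr_minus_divide)
      then show False unfolding summable_real_powr_iff by simp
    qed
  next
    fix \<epsilon> :: real assume "\<epsilon> > 0"
    then have "eventually (\<lambda>n. exp (\<rho> n * (w n + 1)\<^sup>2 / (1 - (\<rho> n)\<^sup>2)) / sqrt (1 - (\<rho> n)\<^sup>2) < 1 + \<epsilon>) sequentially"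
      using order_tendstoD(2)[OF factor, of "1 + \<epsilon>"] by simp
    from eventually_conj[OF this good]
    obtain N where N: "\<And>n. n \<ge> N \<Longrightarrow> exp (\<rho> n * (w n + 1)\<^sup>2 / (1 - (\<rho> n)\<^sup>2)) / sqrt (1 - (\<rho> n)\<^sup>2) < 1 + \<epsilon> \<and> good n"
      unfolding eventually_sequentially by blast
    have "prob (B i \<inter> B j) \<le> (1 + \<epsilon>) * (prob (B i) * prob (B j))" if "N \<le> i" "i < j" for i j
    proof -
      have "prob (B i \<inter> B j) \<le> exp (\<rho> j * (w j + 1)\<^sup>2 / (1 - (\<rho> j)\<^sup>2)) / sqrt (1 - (\<rho> j)\<^sup>2) * (prob (B i) * prob (B j))"
        using N[of i] N[of j] that by (intro pair) auto
      also have "\<dots> \<le> (1 + \<epsilon>) * (prob (B i) * prob (B j))"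
        using N[of j] that by (intro mult_right_mono) auto
      finally show ?thesis .
    qed
    then have "prob (B i \<inter> B j) \<le> (1 + \<epsilon>) * (prob (B i) * prob (B j))" if "N \<le> i" "N \<le> j" "i \<noteq> j" for i j
      using that by (metis Int_commute linorder_neqE_nat mult.commute)
    then show "\<exists>N. \<forall>i\<ge>N. \<forall>j\<ge>N. i \<noteq> j \<longrightarrow> prob (B i \<inter> B j) \<le> (1 + \<epsilon>) * (prob (B i) * prob (B j))"
      by blast
  qed
  have B_imp: "eventually (\<lambda>n. \<forall>\<omega>\<in>B n. ereal (level \<theta> (t n)) \<le> storage_process X c (t n) \<omega>) sequentially"
    using eventually_compose_filterlim[OF AI_exponent_upper[OF AI c_pos \<delta>(2)] u_lim] good
      filterlim_at_top_dense[THEN iffD1, OF u_lim, rule_format, of 0]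
  proof eventually_elim
    case (elim n)
    have n: "n \<ge> 1" and \<tau>n: "\<tau> n > 0" "v (\<tau> n) > 0" using elim by (auto simp: good_def)
    have t1: "t n \<ge> 1" using n \<delta> by (simp add: t_def ge_one_powr_ge_zero)
    have "(u n + c * \<tau> n)\<^sup>2 / v (\<tau> n) \<le> (1 + \<delta>) * ((storage_const c \<alpha>)\<^sup>2 / A) * u n powr (2 - 2 * \<alpha>)"
      using elim(1) by (simp add: \<tau>_def k_def)
    also have "\<dots> = (1 + \<delta>) * ((storage_const c \<alpha>)\<^sup>2 / A) * (\<theta> * K * ((1 + \<delta>) * ln (real n)))"
      using level_powr[OF \<theta>(1) t1] n by (simp add: u_def t_def ln_powr)
    also have "\<dots> = 2 * q * ln (real n)"
      using parameters storage_const_pos[of c \<alpha>] c_pos by (simp add: K_def q_def power2_eq_square)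
    also have "\<dots> = (w n)\<^sup>2" using q n by (simp add: w_def)
    \<comment> \<open>The window height w n was fixed so that (w n)^2 / 2 = q ln n, which is where
      the bound on the exponent ends. So a normalized increment above w n exceeds the required u + c
      \<tau>.\<close>
    finally have "(u n + c * \<tau> n)\<^sup>2 \<le> (w n * sqrt (v (\<tau> n)))\<^sup>2"
      using \<tau>n by (simp add: pos_divide_le_eq power_mult_distrib)
    then have le: "u n + c * \<tau> n \<le> w n * sqrt (v (\<tau> n))"
      by (rule power2_le_imp_le) (use w_nonneg[OF n] \<tau>n in auto)
    show ?case
    proof
      fix \<omega> assume "\<omega> \<in> B n"
      then have "w n < 1 / sqrt (v (\<tau> n)) * (X (t n) \<omega> - X (t n - \<tau> n) \<omega>)" by (simp add: B_def Y_def)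
      then have "w n * sqrt (v (\<tau> n)) < X (t n) \<omega> - X (t n - \<tau> n) \<omega>"
        using \<tau>n by (simp add: pos_less_divide_eq)
      with le have "u n \<le> X (t n) \<omega> - X (t n - \<tau> n) \<omega> - c * (t n - (t n - \<tau> n))" by simp
      then have "ereal (u n) \<le> ereal (X (t n) \<omega> - X (t n - \<tau> n) \<omega> - c * (t n - (t n - \<tau> n)))" by simp
      also have "\<dots> \<le> storage_process X c (t n) \<omega>"
        unfolding storage_process_def by (rule SUP_upper) (use \<tau>n in auto)
      finally show "ereal (level \<theta> (t n)) \<le> storage_process X c (t n) \<omega>" by (simp add: u_def)
    qed
  qed
  from io show ?thesis
  proof eventually_elim
    case (elim \<omega>)
    have "eventually (\<lambda>n. \<omega> \<in> B n \<longrightarrow> ereal (level \<theta> (t n)) \<le> storage_process X c (t n) \<omega>) sequentially"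
      using B_imp by eventually_elim auto
    then have "\<exists>\<^sub>F n in sequentially. ereal (level \<theta> (t n)) \<le> storage_process X c (t n) \<omega>"
      using elim unfolding cofinite_eq_sequentially by (rule frequently_mp)
    then show ?case
      unfolding frequently_def
      using eventually_compose_filterlim[OF _ t_lim] by blast
  qed
qed

end

section \<open>The limit superior\<close>

context storage_model
begin

lemma level_factor:
  assumes "\<theta> > 0" "t \<ge> 1"
  shows "level \<theta> t = (\<theta> * K) powr (1 / (2 * (1 - \<alpha>))) * ln t powr (1 / (2 * (1 - \<alpha>)))"
  using assms K_pos by (simp add: level_def powr_mult)

lemma level_mono:
  assumes "\<theta> > 0" "1 \<le> s" "s \<le> t"
  shows "level \<theta> s \<le> level \<theta> t"
  using assms K_pos parameters by (auto simp: level_def intro!: powr_mono2 mult_left_mono)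

lemma ln_powr_exponent_at_top:
  "filterlim (\<lambda>t. ln t powr (1 / (2 * (1 - \<alpha>)))) at_top at_top"
  using ln_powr_at_top[of 1 "1 / (2 * (1 - \<alpha>))"] parameters by simp

text \<open>With n the integer part of t, the level at n is at most the level at t, and the additive
  c vanishes after division by the diverging power of ln t.\<close>

lemma Limsup_storage_le:
  assumes \<theta>: "\<theta> > 1"
  shows "AE \<omega> in M. Limsup at_top (\<lambda>t. storage_process X c t \<omega> / ereal (ln t powr (1 / (2 * (1 - \<alpha>)))))
    \<le> ereal ((\<theta> * K) powr (1 / (2 * (1 - \<alpha>))))"
  using storage_eventually_le_level[OF \<theta>]
proof eventually_elim
  case (elim \<omega>)
  let ?D = "\<lambda>t. ln t powr (1 / (2 * (1 - \<alpha>)))" and ?L = "(\<theta> * K) powr (1 / (2 * (1 - \<alpha>)))"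
  obtain N :: nat where N: "\<And>n t. n \<ge> N \<Longrightarrow> real n \<le> t \<Longrightarrow> t < real n + 1 \<Longrightarrow>
    storage_process X c t \<omega> \<le> ereal (level \<theta> (real n) + c)" using elim by blast
  have "eventually (\<lambda>t. storage_process X c t \<omega> / ereal (?D t) \<le> ereal (?L + c / ?D t)) at_top"
    using eventually_ge_at_top[of "real N + 1"] filterlim_at_top_dense[THEN iffD1, OF ln_powr_exponent_at_top, rule_format, of 0]
  proof eventually_elim
    case (elim t)
    define n where "n = nat \<lfloor>t\<rfloor>"
    have n: "real n \<le> t" "t < real n + 1" "n \<ge> N" "n \<ge> 1"
      using elim(1) unfolding n_def by linarith+
    have "storage_process X c t \<omega> \<le> ereal (level \<theta> (real n) + c)" using n by (intro N) auto
    also have "\<dots> \<le> ereal (level \<theta> t + c)" using level_mono[of \<theta> "real n" t] n \<theta> by simp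
    also have "level \<theta> t = ?L * ?D t" using level_factor[of \<theta> t] n \<theta> by simp
    finally have "storage_process X c t \<omega> / ereal (?D t) \<le> ereal (?L * ?D t + c) / ereal (?D t)"
      using elim(2) by (intro ereal_divide_right_mono) auto
    also have "\<dots> = ereal (?L + c / ?D t)" using elim(2) by (simp add: add_divide_distrib)
    finally show ?case .
  qed
  then have "Limsup at_top (\<lambda>t. storage_process X c t \<omega> / ereal (?D t)) \<le> Limsup at_top (\<lambda>t. ereal (?L + c / ?D t))"
    by (rule Limsup_mono)
  also have "\<dots> = ereal ?L"
  proof (rule lim_imp_Limsup)
    have "((\<lambda>t. ?L + c / ?D t) \<longlongrightarrow> ?L + 0) at_top"
      by (intro tendsto_add tendsto_const tendsto_divide_0[OF tendsto_const]
          filterlim_at_top_imp_at_infinity ln_powr_exponent_at_top)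
    then show "((\<lambda>t. ereal (?L + c / ?D t)) \<longlongrightarrow> ereal ?L) at_top" by simp
  qed simp
  finally show ?case .
qed

lemma Limsup_storage_ge:
  assumes \<theta>: "0 < \<theta>" "\<theta> < 1"
  shows "AE \<omega> in M. ereal ((\<theta> * K) powr (1 / (2 * (1 - \<alpha>))))
    \<le> Limsup at_top (\<lambda>t. storage_process X c t \<omega> / ereal (ln t powr (1 / (2 * (1 - \<alpha>)))))"
  using storage_frequently_ge_level[OF \<theta>]
proof eventually_elim
  case (elim \<omega>)
  let ?D = "\<lambda>t. ln t powr (1 / (2 * (1 - \<alpha>)))" and ?L = "(\<theta> * K) powr (1 / (2 * (1 - \<alpha>)))"
  have "eventually (\<lambda>t. ereal (level \<theta> t) \<le> storage_process X c t \<omega> \<longrightarrow> ereal ?L \<le> storage_process X c t \<omega> / ereal (?D t)) at_top"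
    using eventually_ge_at_top[of 1] filterlim_at_top_dense[THEN iffD1, OF ln_powr_exponent_at_top, rule_format, of 0]
  proof eventually_elim
    case (elim t)
    show ?case
    proof
      assume "ereal (level \<theta> t) \<le> storage_process X c t \<omega>"
      then have "ereal (?L * ?D t) / ereal (?D t) \<le> storage_process X c t \<omega> / ereal (?D t)"
        using level_factor[of \<theta> t] elim \<theta> by (intro ereal_divide_right_mono) auto
      then show "ereal ?L \<le> storage_process X c t \<omega> / ereal (?D t)" using elim(2) by simp
    qed
  qed
  then have freq: "\<exists>\<^sub>F t in at_top. ereal ?L \<le> storage_process X c t \<omega> / ereal (?D t)"
    using elim by (rule frequently_mp)
  show ?case
  proof (rule ccontr)
    assume "\<not> ?case"
    then have "eventually (\<lambda>t. storage_process X c t \<omega> / ereal (?D t) < ereal ?L) at_top"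
      by (intro Limsup_lessD) (simp add: not_le)
    with freq show False by (auto simp: frequently_def not_le)
  qed
qed

lemma Limsup_storage:
  "AE \<omega> in M. Limsup at_top (\<lambda>t. storage_process X c t \<omega> / ereal (ln t powr (1 / (2 * (1 - \<alpha>)))))
    = ereal (K powr (1 / (2 * (1 - \<alpha>))))"
proof -
  let ?b = "1 / (2 * (1 - \<alpha>))"
  have up: "AE \<omega> in M. \<forall>n::nat. Limsup at_top (\<lambda>t. storage_process X c t \<omega> / ereal (ln t powr ?b))
      \<le> ereal (((1 + 1 / real (Suc n)) * K) powr ?b)"
    unfolding AE_all_countable by (intro allI Limsup_storage_le) simp
  \<comment> \<open>The shift by 2 keeps \<theta> strictly between 0 and 1 already at n = 0.
    Countably many values of \<theta> share one null set.\<close>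
  have low: "AE \<omega> in M. \<forall>n::nat. ereal (((1 - 1 / real (n + 2)) * K) powr ?b)
      \<le> Limsup at_top (\<lambda>t. storage_process X c t \<omega> / ereal (ln t powr ?b))"
    unfolding AE_all_countable by (intro allI Limsup_storage_ge) auto
  have lim: "(\<lambda>n. ereal ((f n * K) powr ?b)) \<longlonglongrightarrow> ereal (K powr ?b)" if "f \<longlonglongrightarrow> 1" for f :: "nat \<Rightarrow> real"
  proof -
    have "(\<lambda>n. (f n * K) powr ?b) \<longlonglongrightarrow> (1 * K) powr ?b"
      using K_pos that by (intro tendsto_intros) auto
    then show ?thesis by simp
  qed
  have f: "(\<lambda>n. 1 + 1 / real (Suc n)) \<longlonglongrightarrow> 1" "(\<lambda>n. 1 - 1 / real (n + 2)) \<longlonglongrightarrow> 1" by real_asymp+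
  from up low show ?thesis
  proof eventually_elim
    case (elim \<omega>)
    show ?case
    proof (rule antisym)
      show "Limsup at_top (\<lambda>t. storage_process X c t \<omega> / ereal (ln t powr ?b)) \<le> ereal (K powr ?b)"
        by (rule LIMSEQ_le_const[OF lim[OF f(1)]]) (use elim in auto)
      show "ereal (K powr ?b) \<le> Limsup at_top (\<lambda>t. storage_process X c t \<omega> / ereal (ln t powr ?b))"
        by (rule LIMSEQ_le_const2[OF lim[OF f(2)]]) (use elim in auto)
    qed
  qed
qed

end

theorem corollary1:
  fixes M :: "'w measure" and X :: "real \<Rightarrow> 'w \<Rightarrow> real"
    and c A_inf \<alpha>_inf A_0 \<alpha>_0 :: real
  assumes "prob_space M"
    and "centered_gaussian_process M X"
    and "stationary_increments M X"
    and "AE \<omega> in M. X 0 \<omega> = 0"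
    and "AE \<omega> in M. continuous_on UNIV (\<lambda>t. X t \<omega>)"
    and "assumption_AI (variance_function M X) A_inf \<alpha>_inf"
    and "assumption_AII (variance_function M X) A_0 \<alpha>_0"
    and "c > 0"
  shows "AE \<omega> in M.
    Limsup at_top (\<lambda>t::real. storage_process X c t \<omega> / ereal (ln t powr (1 / (2 * (1 - \<alpha>_inf)))))
      = ereal ((2 * A_inf / (storage_const c \<alpha>_inf)\<^sup>2) powr (1 / (2 * (1 - \<alpha>_inf))))"
proof -
  interpret prob_space M by fact
  interpret storage_model M X c A_inf \<alpha>_inf A_0 \<alpha>_0
    by unfold_locales (use assms in auto)
  show ?thesis using Limsup_storage by (simp only: K_def)
qed

end
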